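(* Let $(\Omega,\mathcal B,\mathbb P,(\mathfrak P_N)_{N\in\mathfrak N})$ be an $\mathfrak N$-refined standard Borel probability space. Then for every $\gamma\in\Gamma(\mathbb P,\mathbb P)$ there exist a totally ordered strictly increasing sequence $(N_n)_n\subset\mathfrak N$ and maps $g_n\in\mathrm S(\Omega,\mathcal B,\mathbb P;\mathcal B_{N_n})$ such that, for every Polish topology $\tau$ on $\Omega$ generating $\mathcal B$, it holds $$(\mathrm{id}_\Omega,g_n)_\sharp\mathbb P\to\gamma\quad\text{in }\mathcal P(\Omega\times\Omega,\tau\otimes\tau)\text{ as }n\to\infty,$$ where $\tau\otimes\tau$ is the product topology on $\Omega\times\Omega$.
   Context: On the positive integers write $m\prec n$ iff $m\mid n$; "totally ordered" and "strictly increasing" refer to $\prec$. $\mathfrak N\subset\mathbb N$ is an unbounded set directed w.r.t. $\prec$. For $N\in\mathbb N$, $I_N:=\{0,\dots,N-1\}$. Let $(\Omega,\mathcal B)$ be a standard Borel space with a nonatomic positive finite measure $\mathfrak m$. An $N$-partition is a family $\{\Omega_{N,k}\}_{k\in I_N}\subset\mathcal B$ of pairwise disjoint sets with union $\Omega$. An $\mathfrak N$-segmentation of $(\Omega,\mathcal B,\mathfrak m)$ is a collection $(\mathfrak P_N)_{N\in\mathfrak N}$, with $\mathcal B_N:=\sigma(\mathfrak P_N)$, such that: (1) $\mathfrak P_N=\{\Omega_{N,k}\}_{k\in I_N}$ is an $N$-partition for every $N\in\mathfrak N$; (2) $\mathfrak m(\Omega_{N,k})=\mathfrak m(\Omega)/N$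 for all $k\in I_N$, $N\in\mathfrak N$; (3) if $M,N\in\mathfrak N$ and $N=KM$, then $\bigcup_{k=0}^{K-1}\Omega_{N,mK+k}=\Omega_{M,m}$ for $m\in I_M$; (4) $\sigma(\{\mathcal B_N:N\in\mathfrak N\})=\mathcal B$. Then $(\Omega,\mathcal B,\mathfrak m,(\mathfrak P_N)_{N\in\mathfrak N})$ is called an $\mathfrak N$-refined standard Borel measure space (probability space if $\mathfrak m$ is a probability). $\mathrm S(\Omega,\mathcal B,\mathbb P)$ is the class of $\mathcal B$-$\mathcal B$-measurable maps $g:\Omega\to\Omega$ that are essentially injective (injective on a set of full measure in $\mathcal B$) and satisfy $g_\sharp\mathbb P=\mathbb P$; $\mathrm S(\Omega,\mathcal B,\mathbb P;\mathcal A)$ is the subset of those which are also $\mathcal A$-$\mathcal A$ measurable, for a sub-$\sigma$-algebra $\mathcal A\subset\mathcal B$. $\Gamma(\mathbb P,\mathbb P)$ is the set of probability measures on $\Omega\times\Omega$ with both marginals equal to $\mathbb P$. Convergence in $\mathcal P(\Omega\times\Omega,\tau\otimes\tau)$ is narrow convergence, i.e. against bounded $\tau\otimes\tau$-continuous functions. *)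

theory Defs
  imports "HOL-Probability.Probability"
begin

section \<open>Polish topologies and standard Borel spaces\<close>

definition borel_of :: "'a topology \<Rightarrow> 'a measure" where
  "borel_of X = sigma (topspace X) {U. openin X U}"

definition polish_topology :: "'a topology \<Rightarrow> bool" where
  "polish_topology X \<longleftrightarrow> completely_metrizable_space X \<and> separable_space X"

text \<open>Equality of the two families of measurable sets includes
  \<^prop>\<open>topspace \<tau> = space M\<close>, since the space of a measure is its largest measurable set.\<close>

definition polish_topology_generating :: "'a topology \<Rightarrow> 'a measure \<Rightarrow> bool" where
  "polish_topology_generating \<tau> M \<longleftrightarrow> polish_topology \<tau> \<and> sets (borel_of \<tau>) = sets M"

definition standard_borel :: "'a measure \<Rightarrow> bool" where
  "standard_borel M \<longleftrightarrow> (\<exists>\<tau>. polish_topology_generating \<tau> M)"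

definition nonatomic :: "'a measure \<Rightarrow> bool" where
  "nonatomic M \<longleftrightarrow>
     (\<forall>A\<in>sets M. 0 < emeasure M A \<longrightarrow>
        (\<exists>B\<in>sets M. B \<subseteq> A \<and> 0 < emeasure M B \<and> emeasure M B < emeasure M A))"


section \<open>Divisibility order and segmentations\<close>

text \<open>A set of positive integers, unbounded and directed for divisibility.\<close>

definition dvd_directed_index_set :: "nat set \<Rightarrow> bool" where
  "dvd_directed_index_set NN \<longleftrightarrow>
     (\<forall>N\<in>NN. 0 < N) \<and> \<not> bdd_above NN \<and>
     (\<forall>M\<in>NN. \<forall>N\<in>NN. \<exists>K\<in>NN. M dvd K \<and> N dvd K)"

definition dvd_totally_ordered :: "nat set \<Rightarrow> bool" where
  "dvd_totally_ordered S \<longleftrightarrow> (\<forall>m\<in>S. \<forall>n\<in>S. m dvd n \<or> n dvd m)"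

definition dvd_strictly_increasing :: "(nat \<Rightarrow> nat) \<Rightarrow> bool" where
  "dvd_strictly_increasing N \<longleftrightarrow> (\<forall>i j. i < j \<longrightarrow> N i dvd N j \<and> N i \<noteq> N j)"

text \<open>The \<open>N\<close>-th partition of a segmentation \<open>P\<close> is the family \<open>P N k\<close> with \<open>k < N\<close>;
  values \<open>P N k\<close> with \<open>N \<le> k\<close> or \<open>N\<close> outside the index set are irrelevant.\<close>

definition is_partition :: "'a measure \<Rightarrow> nat \<Rightarrow> (nat \<Rightarrow> 'a set) \<Rightarrow> bool" where
  "is_partition M N Q \<longleftrightarrow>
     (\<forall>k<N. Q k \<in> sets M) \<and> disjoint_family_on Q {..<N} \<and> (\<Union>k<N. Q k) = space M"

definition partition_algebra :: "'a measure \<Rightarrow> (nat \<Rightarrow> nat \<Rightarrow> 'a set) \<Rightarrow> nat \<Rightarrow> 'a measure" where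
  "partition_algebra M P N = sigma (space M) (P N ` {..<N})"

definition segmentation :: "nat set \<Rightarrow> 'a measure \<Rightarrow> (nat \<Rightarrow> nat \<Rightarrow> 'a set) \<Rightarrow> bool" where
  "segmentation NN M P \<longleftrightarrow>
     (\<forall>N\<in>NN. is_partition M N (P N)) \<and>
     (\<forall>N\<in>NN. \<forall>k<N. measure M (P N k) = measure M (space M) / real N) \<and>
     (\<forall>M'\<in>NN. \<forall>N\<in>NN. \<forall>K. N = K * M' \<longrightarrow>
        (\<forall>m<M'. (\<Union>k<K. P N (m * K + k)) = P M' m)) \<and>
     sigma_sets (space M) (\<Union>N\<in>NN. sets (partition_algebra M P N)) = sets M"

definition refined_standard_borel_measure_space ::
    "nat set \<Rightarrow> 'a measure \<Rightarrow> (nat \<Rightarrow> nat \<Rightarrow> 'a set) \<Rightarrow> bool" where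
  "refined_standard_borel_measure_space NN M P \<longleftrightarrow>
     dvd_directed_index_set NN \<and> standard_borel M \<and> finite_measure M \<and> nonatomic M \<and>
     segmentation NN M P"

definition refined_standard_borel_prob_space ::
    "nat set \<Rightarrow> 'a measure \<Rightarrow> (nat \<Rightarrow> nat \<Rightarrow> 'a set) \<Rightarrow> bool" where
  "refined_standard_borel_prob_space NN M P \<longleftrightarrow>
     refined_standard_borel_measure_space NN M P \<and> prob_space M"


section \<open>Measure-preserving essentially injective maps\<close>

definition essentially_injective :: "'a measure \<Rightarrow> ('a \<Rightarrow> 'b) \<Rightarrow> bool" where
  "essentially_injective M g \<longleftrightarrow>
     (\<exists>A\<in>sets M. emeasure M (space M - A) = 0 \<and> inj_on g A)"

definition S_maps :: "'a measure \<Rightarrow> ('a \<Rightarrow> 'a) set" where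
  "S_maps M = {g \<in> M \<rightarrow>\<^sub>M M. essentially_injective M g \<and> distr M M g = M}"

text \<open>The sub-\<open>\<sigma>\<close>-algebra is represented by a measure \<open>A\<close> of which only space and measurable
  sets are used.\<close>

definition S_maps_sub :: "'a measure \<Rightarrow> 'a measure \<Rightarrow> ('a \<Rightarrow> 'a) set" where
  "S_maps_sub M A = {g \<in> S_maps M. g \<in> A \<rightarrow>\<^sub>M A}"


section \<open>Couplings and narrow convergence\<close>

definition couplings :: "'a measure \<Rightarrow> 'b measure \<Rightarrow> ('a \<times> 'b) measure set" where
  "couplings M N =
     {\<gamma>. prob_space \<gamma> \<and> sets \<gamma> = sets (M \<Otimes>\<^sub>M N) \<and> distr \<gamma> M fst = M \<and> distr \<gamma> N snd = N}"

definition borel_probabilities :: "'a topology \<Rightarrow> 'a measure set" where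
  "borel_probabilities X = {\<mu>. prob_space \<mu> \<and> sets \<mu> = sets (borel_of X)}"

definition converges_narrowly ::
    "'a topology \<Rightarrow> (nat \<Rightarrow> 'a measure) \<Rightarrow> 'a measure \<Rightarrow> bool" where
  "converges_narrowly X \<mu> \<nu> \<longleftrightarrow>
     (\<forall>n. \<mu> n \<in> borel_probabilities X) \<and> \<nu> \<in> borel_probabilities X \<and>
     (\<forall>f. continuous_map X euclideanreal f \<and> bounded (f ` topspace X) \<longrightarrow>
        (\<lambda>n. integral\<^sup>L (\<mu> n) f) \<longlonglongrightarrow> integral\<^sup>L \<nu> f)"

end

theory Submission
  imports Defs
begin

text \<open>
  A coupling \<open>\<gamma>\<close> seen at the resolution of the \<open>N\<close>-th partition is an \<open>N \<times> N\<close> matrix of masses with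
  all row and column sums \<open>1/N\<close>. If each cell is cut into \<open>K\<close> equal subcells with \<open>K\<close> large, this
  matrix is, up to an error below \<open>1/K\<close> per entry, the matrix that counts how a permutation of the \<open>NK\<close> subcells
  moves them between the \<open>N\<close> blocks: round the numbers \<open>NK\<gamma>(\<Omega>\<^sub>i \<times> \<Omega>\<^sub>j)\<close> down and extend the resulting
  partial matching to a permutation (\<open>bij_with_block_counts\<close>).

  Such a permutation is realised by an essentially injective measure-preserving map
  (\<open>realize_permutation\<close>). A point is determined by its address, the sequence of the indices of the
  cells that contain it. The map permutes the first entry of the address and carries the relative
  position inside the cell along; the only question is whether a point with the new address exists.
  This is where the Polish topology enters: up to small measure the cells can be replaced by
  compact subsets, and then any nested sequence of cells that all meet a suitable compact set has a
  common point (\<open>compact_cell_class\<close>). Counting cells shows that almost all new addresses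
  are of this kind.

  Along a cofinal divisibility chain \<open>c\<close> with \<open>c (n + 1) \<ge> (n + 1) (c n)\<^sup>2\<close> the error on every
  union of rectangles of cells of level \<open>n\<close> is at most \<open>1/(n + 1)\<close>, so the plans induced by the maps converge
  to \<open>\<gamma>\<close> on every rectangle of cells. All plans have the same marginals, hence Dynkin's
  argument, with dominated convergence supplied by the common marginals, extends this to all measurable
  rectangles (\<open>rectangles_converge\<close>). That statement does not mention a topology. For a Polish topology,
  a bounded continuous function is the increasing limit of step functions over measurable rectangles,
  and narrow convergence follows (\<open>narrow_convergence_of_rectangles\<close>).
\<close>

section \<open>Polish topologies generating a given \<sigma>-algebra\<close>

lemma borel_of_simps [simp]:
  "space (borel_of X) = topspace X" "sets (borel_of X) = sigma_sets (topspace X) {U. openin X U}"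
proof -
  have "{U. openin X U} \<subseteq> Pow (topspace X)"
    using openin_subset by auto
  then show "space (borel_of X) = topspace X"
      "sets (borel_of X) = sigma_sets (topspace X) {U. openin X U}"
    by (simp_all add: borel_of_def)
qed

lemma generating_space:
  assumes "polish_topology_generating \<tau> M"
  shows "topspace \<tau> = space M"
  using assms sets_eq_imp_space_eq unfolding polish_topology_generating_def by (metis borel_of_simps(1))

lemma generating_open:
  assumes "polish_topology_generating \<tau> M" "openin \<tau> U"
  shows "U \<in> sets M"
proof -
  have "U \<in> sets (borel_of \<tau>)"
    using assms(2) by (auto intro: sigma_sets.Basic)
  then show ?thesis using assms(1) by (simp only: polish_topology_generating_def)
qed

lemma generating_closed:
  assumes "polish_topology_generating \<tau> M" "closedin \<tau> F"
  shows "F \<in> sets M"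
proof -
  have "space M - (space M - F) \<in> sets M"
    using generating_open[OF assms(1)] assms(2) generating_space[OF assms(1)]
    by (auto simp: closedin_def)
  moreover have "space M - (space M - F) = F"
    using closedin_subset[OF assms(2)] generating_space[OF assms(1)] by auto
  ultimately show ?thesis by simp
qed

lemma polish_imp_second_countable:
  assumes "polish_topology X"
  shows "second_countable X"
proof -
  obtain S d where S: "Metric_space S d" "X = Metric_space.mtopology S d"
    using assms by (auto simp: polish_topology_def completely_metrizable_space_def)
  interpret Metric_space S d by fact
  obtain C where C: "countable C" "C \<subseteq> S" "mtopology closure_of C = S"
    using assms by (auto simp: polish_topology_def separable_space_def S(2))
  let ?B = "(\<lambda>(x, n). mball x (inverse (real (Suc n)))) ` (C \<times> UNIV)"
  have "\<exists>V\<in>?B. x \<in> V \<and> V \<subseteq> U" if U: "openin mtopology U" "x \<in> U" for U x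
  proof -
    obtain r where r: "r > 0" "mball x r \<subseteq> U"
      using U openin_mtopology by metis
    have xS: "x \<in> S" using U openin_mtopology by blast
    obtain n where n: "inverse (real (Suc n)) < r / 2"
      using reals_Archimedean[of "r / 2"] r by auto
    obtain y where y: "y \<in> C" "y \<in> mball x (inverse (real (Suc n)))"
    proof -
      have "x \<in> mtopology closure_of C" using C(3) xS by simp
      then have "\<forall>r>0. \<exists>y\<in>C. y \<in> mball x r" unfolding metric_closure_of by simp
      then show ?thesis using that by (meson inverse_positive_iff_positive of_nat_0_less_iff zero_less_Suc)
    qed
    have "x \<in> mball y (inverse (real (Suc n)))"
      using y by (auto simp: commute)
    moreover have "mball y (inverse (real (Suc n))) \<subseteq> mball x r"
    proof
      fix z assume z: "z \<in> mball y (inverse (real (Suc n)))"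
      with y xS have "d x z \<le> d x y + d y z" by (auto intro: triangle)
      with z y n xS show "z \<in> mball x r" by auto
    qed
    ultimately show ?thesis
      using y(1) r(2) by blast
  qed
  moreover have "countable ?B" using C(1) by auto
  ultimately show ?thesis
    unfolding second_countable_def S(2) by (intro exI[of _ ?B]) auto
qed

text \<open>By second countability every open set of the product is a countable union of open
  rectangles, so it lies in the product \<open>\<sigma>\<close>-algebra.\<close>

lemma borel_of_prod_topology:
  assumes gen: "polish_topology_generating \<tau> M"
  shows "sets (borel_of (prod_topology \<tau> \<tau>)) = sets (M \<Otimes>\<^sub>M M)"
proof -
  let ?T = "prod_topology \<tau> \<tau>"
  note sp = generating_space[OF gen]
  have "second_countable \<tau>"
    using gen by (intro polish_imp_second_countable) (simp add: polish_topology_generating_def)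
  then obtain B where B: "countable B" "\<And>V. V \<in> B \<Longrightarrow> openin \<tau> V"
      and base: "\<forall>U x. openin \<tau> U \<and> x \<in> U \<longrightarrow> (\<exists>V\<in>B. x \<in> V \<and> V \<subseteq> U)"
    unfolding second_countable_def by auto
  have "W \<in> sets (M \<Otimes>\<^sub>M M)" if W: "openin ?T W" for W
  proof -
    let ?R = "{R \<in> (\<lambda>(U, V). U \<times> V) ` (B \<times> B). R \<subseteq> W}"
    have box: "\<exists>U V. openin \<tau> U \<and> openin \<tau> V \<and> x \<in> U \<and> y \<in> V \<and> U \<times> V \<subseteq> W"
      if "(x, y) \<in> W" for x y
      using W that by (simp add: openin_prod_topology_alt)
    have "W = \<Union>?R"
    proof
      show "W \<subseteq> \<Union>?R"
      proof (rule subrelI)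
        fix x y assume "(x, y) \<in> W"
        from box[OF this] obtain U V
          where "openin \<tau> U" "openin \<tau> V" "x \<in> U" "y \<in> V" "U \<times> V \<subseteq> W"
          by (elim exE conjE) (rule that)
        moreover obtain U' where "U' \<in> B" "x \<in> U'" "U' \<subseteq> U"
          using base \<open>openin \<tau> U\<close> \<open>x \<in> U\<close> by blast
        moreover obtain V' where "V' \<in> B" "y \<in> V'" "V' \<subseteq> V"
          using base \<open>openin \<tau> V\<close> \<open>y \<in> V\<close> by blast
        ultimately have "U' \<times> V' \<in> ?R" "(x, y) \<in> U' \<times> V'" by auto
        then show "(x, y) \<in> \<Union>?R" by (rule UnionI)
      qed
    qed auto
    moreover have "countable ?R"
      using B(1) by auto
    moreover have "?R \<subseteq> sets (M \<Otimes>\<^sub>M M)"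
      using generating_open[OF gen] B(2) by auto
    ultimately show ?thesis
      using sets.countable_Union[of ?R "M \<Otimes>\<^sub>M M"] by (simp only:)
  qed
  then have "sets (borel_of ?T) \<subseteq> sets (M \<Otimes>\<^sub>M M)"
    using sets.sigma_sets_subset[of "{U. openin ?T U}" "M \<Otimes>\<^sub>M M"]
    by (auto simp: space_pair_measure sp)
  moreover have "sets (M \<Otimes>\<^sub>M M) \<subseteq> sets (borel_of ?T)"
  proof -
    have M: "sets M = sets (borel_of \<tau>)" using gen by (simp add: polish_topology_generating_def)
    have f: "fst \<in> borel_of ?T \<rightarrow>\<^sub>M borel_of \<tau>" "snd \<in> borel_of ?T \<rightarrow>\<^sub>M borel_of \<tau>"
      unfolding borel_of_def[of \<tau>]
      using openin_continuous_map_preimage[OF continuous_map_fst[of \<tau> \<tau>]]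
         openin_continuous_map_preimage[OF continuous_map_snd[of \<tau> \<tau>]] openin_subset[of \<tau>]
      by (auto intro!: measurable_measure_of sigma_sets.Basic
            simp: vimage_def Int_def conj_commute)
    have "fst -` A \<inter> space (borel_of ?T) \<inter> (snd -` C \<inter> space (borel_of ?T)) \<in> sets (borel_of ?T)"
       if "A \<in> sets M" "C \<in> sets M" for A C
      using that unfolding M by (intro sets.Int measurable_sets[OF f(1)] measurable_sets[OF f(2)])
    moreover have "fst -` A \<inter> space (borel_of ?T) \<inter> (snd -` C \<inter> space (borel_of ?T)) = A \<times> C"
       if "A \<in> sets M" "C \<in> sets M" for A C
      using that sets.sets_into_space by (fastforce simp: sp)
    ultimately have "{A \<times> C |A C. A \<in> sets M \<and> C \<in> sets M} \<subseteq> sets (borel_of ?T)"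
      by (auto simp del: borel_of_simps)
    then have "sigma_sets (space (borel_of ?T)) {A \<times> C |A C. A \<in> sets M \<and> C \<in> sets M}
       \<subseteq> sets (borel_of ?T)"
      by (rule sets.sigma_sets_subset)
    then show ?thesis
      by (simp add: sets_pair_measure sp)
  qed
  ultimately show ?thesis by auto
qed

text \<open>Sets that can be squeezed between a closed and an open set with small difference form a
  \<open>\<sigma>\<close>-algebra, and it contains the open sets because these are countable unions of closed sets.\<close>

lemma closed_inner_regular:
  assumes gen: "polish_topology_generating \<tau> M" and fin: "finite_measure M"
    and A: "A \<in> sets M" and e: "e > 0"
  obtains F where "closedin \<tau> F" "F \<subseteq> A" "measure M (A - F) < e"
proof -
  interpret finite_measure M by fact
  note sp = generating_space[OF gen]
  have metr: "metrizable_space \<tau>"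
    using gen by (simp add: polish_topology_generating_def polish_topology_def completely_metrizable_imp_metrizable_space)
  define good where "good A \<longleftrightarrow>
    (\<forall>e>0. \<exists>F U. closedin \<tau> F \<and> openin \<tau> U \<and> F \<subseteq> A \<and> A \<subseteq> U \<and> measure M (U - F) < e)" for A
  have goodD: "\<exists>F U. closedin \<tau> F \<and> openin \<tau> U \<and> F \<subseteq> A \<and> A \<subseteq> U \<and> measure M (U - F) < e"
    if "good A" "e > 0" for A e
    using that unfolding good_def by simp
  have cl[measurable]: "closedin \<tau> F \<Longrightarrow> F \<in> sets M" for F using generating_closed[OF gen] .
  have op[measurable]: "openin \<tau> F \<Longrightarrow> F \<in> sets M" for F using generating_open[OF gen] .
  have "A \<in> sigma_sets (topspace \<tau>) {U. openin \<tau> U}"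
    using A gen by (simp add: polish_topology_generating_def)
  then have "good A"
  proof induction
    case (Basic U)
    then have U: "openin \<tau> U" by simp
    then obtain F where F: "\<And>n. closedin \<tau> (F n)" "\<And>n. F n \<subseteq> F (Suc n)" "(\<Union>n. F n) = U"
      using open_imp_fsigma_in[OF metr] unfolding fsigma_in_ascending by metis
    have "(\<lambda>n. measure M (F n)) \<longlonglongrightarrow> measure M U"
      using F by (metis cl finite_Lim_measure_incseq image_subset_iff incseq_SucI)
    have "\<exists>n. measure M (U - F n) < e" if "e > 0" for e
    proof -
      have "\<forall>\<^sub>F n in sequentially. measure M U - e < measure M (F n)"
        using \<open>(\<lambda>n. measure M (F n)) \<longlonglongrightarrow> measure M U\<close> that
        by (intro order_tendstoD) auto
      then obtain n where "measure M U - e < measure M (F n)"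
        by (auto simp: eventually_sequentially)
      moreover have "measure M (U - F n) = measure M U - measure M (F n)"
        using F U by (intro finite_measure_Diff) auto
      ultimately show ?thesis by (intro exI[of _ n]) simp
    qed
    show ?case unfolding good_def
    proof (intro allI impI)
      fix e :: real assume "e > 0"
      then obtain n where "measure M (U - F n) < e"
        using \<open>\<And>e. e > 0 \<Longrightarrow> \<exists>n. measure M (U - F n) < e\<close> by blast
      then show "\<exists>F V. closedin \<tau> F \<and> openin \<tau> V \<and> F \<subseteq> U \<and> U \<subseteq> V \<and> measure M (V - F) < e"
        using F U by (intro exI[of _ "F n"] exI[of _ U]) auto
    qed
  next
    case Empty
    then show ?case
      unfolding good_def by (intro allI impI exI[of _ "{}"]) auto
  next
    case (Compl A)
    show ?case unfolding good_def
    proof (intro allI impI)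
      fix e :: real assume e: "e > 0"
      obtain F U where FU: "closedin \<tau> F" "openin \<tau> U" "F \<subseteq> A" "A \<subseteq> U" "measure M (U - F) < e"
        using goodD[OF Compl(2) e] by (elim exE conjE) (rule that)
      have "(topspace \<tau> - F) - (topspace \<tau> - U) = U - F"
        using openin_subset[OF FU(2)] by auto
      then show "\<exists>F U. closedin \<tau> F \<and> openin \<tau> U \<and> F \<subseteq> topspace \<tau> - A \<and> topspace \<tau> - A \<subseteq> U
           \<and> measure M (U - F) < e"
        using FU by (intro exI[of _ "topspace \<tau> - U"] exI[of _ "topspace \<tau> - F"]) auto
    qed
  next
    case (Union A)
    show ?case unfolding good_def
    proof (intro allI impI)
      fix e :: real assume e: "e > 0"
      have "\<exists>F U. closedin \<tau> F \<and> openin \<tau> U \<and> F \<subseteq> A i \<and> A i \<subseteq> U \<and>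
          measure M (U - F) < e / 2 * (1/2) ^ Suc i" for i
        using goodD[OF Union(2)[of i], of "e / 2 * (1/2) ^ Suc i"] e by auto
      then obtain F U where FU: "\<And>i. closedin \<tau> (F i)" "\<And>i. openin \<tau> (U i)" "\<And>i. F i \<subseteq> A i"
          "\<And>i. A i \<subseteq> U i" "\<And>i. measure M (U i - F i) < e / 2 * (1/2) ^ Suc i"
        by metis
      have U: "openin \<tau> (\<Union>i. U i)" using FU by auto
      have sm: "(\<lambda>i. e / 2 * (1/2) ^ Suc i) sums (e / 2 * 1)"
        using power_half_series by (intro sums_mult)
      have "(\<lambda>n. measure M (\<Union>i\<le>n. F i)) \<longlonglongrightarrow> measure M (\<Union>n. \<Union>i\<le>n. F i)"
        using FU(1) by (intro finite_Lim_measure_incseq monoI UN_mono) (auto intro!: sets.finite_UN)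
      moreover have "(\<Union>n. \<Union>i\<le>n. F i) = (\<Union>i. F i)" by auto
      ultimately have "\<forall>\<^sub>F n in sequentially. measure M (\<Union>i. F i) - e / 2 < measure M (\<Union>i\<le>n. F i)"
        using e by (intro order_tendstoD) auto
      then obtain n where n: "measure M (\<Union>i. F i) - e / 2 < measure M (\<Union>i\<le>n. F i)"
        by (auto simp: eventually_sequentially)
      have smm: "summable (\<lambda>i. measure M (U i - F i))"
        by (rule summable_comparison_test'[OF sums_summable[OF sm]]) (use FU(5) in \<open>auto simp: less_imp_le\<close>)
      have "measure M ((\<Union>i. U i) - (\<Union>i. F i)) \<le> measure M (\<Union>i. U i - F i)"
        using FU by (intro finite_measure_mono) auto
      also have "\<dots> \<le> (\<Sum>i. measure M (U i - F i))"
        using FU by (intro finite_measure_subadditive_countably smm) auto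
      also have "\<dots> \<le> e / 2"
        using sums_le[OF _ summable_sums[OF smm] sm] FU(5) by (auto simp: less_imp_le)
      finally have 1: "measure M ((\<Union>i. U i) - (\<Union>i. F i)) \<le> e / 2" .
      have "measure M ((\<Union>i. U i) - (\<Union>i\<le>n. F i)) = measure M (\<Union>i. U i) - measure M (\<Union>i\<le>n. F i)"
        using FU by (intro finite_measure_Diff) (auto intro!: sets.finite_UN, blast)
      also have "\<dots> < measure M (\<Union>i. U i) - measure M (\<Union>i. F i) + e / 2" using n by simp
      also have "\<dots> = measure M ((\<Union>i. U i) - (\<Union>i. F i)) + e / 2"
        using FU by (subst finite_measure_Diff) (auto, blast)
      finally have "measure M ((\<Union>i. U i) - (\<Union>i\<le>n. F i)) < e"
        using 1 by simp
      moreover have "closedin \<tau> (\<Union>i\<le>n. F i)" using FU by (intro closedin_Union) auto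
      ultimately show "\<exists>F U. closedin \<tau> F \<and> openin \<tau> U \<and> F \<subseteq> (\<Union>i. A i) \<and> (\<Union>i. A i) \<subseteq> U
           \<and> measure M (U - F) < e"
        using U FU by (intro exI[of _ "\<Union>i\<le>n. F i"] exI[of _ "\<Union>i. U i"]) (auto, blast+)
    qed
  qed
  from goodD[OF this e]
  obtain F U where FU: "closedin \<tau> F" "openin \<tau> U" "F \<subseteq> A" "A \<subseteq> U" "measure M (U - F) < e"
    by (elim exE conjE) (rule that)
  moreover have "measure M (A - F) \<le> measure M (U - F)"
    using FU A by (intro finite_measure_mono) auto
  ultimately show ?thesis using that by force
qed

text \<open>Ulam's argument: by separability finitely many balls of radius \<open>1/(j+1)\<close> cover all but a small part of
  the space; the intersection of these finite unions over all \<open>j\<close> is closed and totally bounded,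
  hence compact by completeness.\<close>

lemma compact_exhaustion:
  assumes gen: "polish_topology_generating \<tau> M" and fin: "finite_measure M" and e: "e > 0"
  obtains K where "compactin \<tau> K" "measure M (space M - K) < e"
proof -
  interpret finite_measure M by fact
  note sp = generating_space[OF gen]
  have pol: "polish_topology \<tau>" using gen by (simp add: polish_topology_generating_def)
  then obtain S d where S: "Metric_space S d" "Metric_space.mcomplete S d" "\<tau> = Metric_space.mtopology S d"
    by (auto simp: polish_topology_def completely_metrizable_space_def)
  interpret d: Metric_space S d by fact
  obtain C where C: "countable C" "C \<subseteq> S" "d.mtopology closure_of C = S"
    using pol by (auto simp: polish_topology_def separable_space_def S(3))
  have SM: "S = space M" using sp by (simp add: S(3))
  have cl[measurable]: "closedin \<tau> F \<Longrightarrow> F \<in> sets M" for F using generating_closed[OF gen] .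
  show ?thesis
  proof (cases "S = {}")
    case True
    then show ?thesis using that[of "{}"] e SM by auto
  next
    case False
    then have "C \<noteq> {}" using C by auto
    then obtain x :: "nat \<Rightarrow> 'a" where x: "range x = C"
      using C(1) by (intro that[of "from_nat_into C"] range_from_nat_into)
    then have xS: "x i \<in> S" for i using C(2) by auto
    define V where "V r n = (\<Union>i\<le>n. d.mcball (x i) r)" for r n
    have Vmono: "V r a \<subseteq> V r b" if "a \<le> b" for r a b
      unfolding V_def using that by (intro UN_mono) auto
    have Vcl: "closedin \<tau> (V r n)" for r n
      unfolding V_def S(3) by (intro closedin_Union) auto
    have small: "\<exists>n. measure M (space M - V r n) < e'" if "r > 0" "e' > 0" for r e'
    proof -
      have "(\<lambda>n. measure M (V r n)) \<longlonglongrightarrow> measure M (\<Union>n. V r n)"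
        using Vcl Vmono by (intro finite_Lim_measure_incseq monoI) auto
      moreover have "(\<Union>n. V r n) = space M"
      proof
        show "(\<Union>n. V r n) \<subseteq> space M" unfolding V_def SM[symmetric] by auto
        show "space M \<subseteq> (\<Union>n. V r n)"
        proof
          fix y assume "y \<in> space M"
          then have "y \<in> d.mtopology closure_of C" using C SM by simp
          then obtain i where "x i \<in> d.mball y r"
            using \<open>r > 0\<close> x unfolding d.metric_closure_of by auto
          then have "y \<in> d.mcball (x i) r" by (auto simp: d.commute)
          then show "y \<in> (\<Union>n. V r n)" unfolding V_def by auto
        qed
      qed
      ultimately have "\<forall>\<^sub>F n in sequentially. measure M (space M) - e' < measure M (V r n)"
        using that by (intro order_tendstoD) auto
      then obtain n where "measure M (space M) - e' < measure M (V r n)"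
        by (auto simp: eventually_sequentially)
      then show ?thesis
        using Vcl by (intro exI[of _ n]) (simp add: finite_measure_compl)
    qed
    have "\<exists>n. measure M (space M - V (1 / Suc j) n) < e / 2 * (1/2) ^ Suc j" for j
      using e by (intro small) auto
    then obtain n where n: "\<And>j. measure M (space M - V (1 / Suc j) (n j)) < e / 2 * (1/2) ^ Suc j"
      by metis
    define K where "K = (\<Inter>j. V (1 / Suc j) (n j))"
    have Kcl: "closedin \<tau> K" unfolding K_def using Vcl by auto
    have KS: "K \<subseteq> S" unfolding SM using closedin_subset[OF Kcl] sp by simp
    have cover: "\<exists>L. finite L \<and> L \<subseteq> S \<and> K \<subseteq> (\<Union>x\<in>L. d.mball x r)" if r: "r > 0" for r
    proof -
      obtain j where "1 / real (Suc j) < r"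
        using nat_approx_posE[OF r] by blast
      then have "d.mcball (x i) (1 / Suc j) \<subseteq> d.mball (x i) r" for i by auto
      then have "K \<subseteq> (\<Union>y\<in>x ` {..n j}. d.mball y r)"
        unfolding K_def V_def by blast
      then show ?thesis using xS by (intro exI[of _ "x ` {..n j}"]) auto
    qed
    have "d.mtotally_bounded K"
      unfolding d.mtotally_bounded_def
    proof (intro allI impI)
      fix r :: real assume "r > 0"
      then obtain L where L: "finite L" "L \<subseteq> S" "K \<subseteq> (\<Union>x\<in>L. d.mball x (r / 2))"
        using cover[of "r / 2"] by auto
      \<comment> \<open>The centres must lie in \<open>K\<close>: move each one to a point of \<open>K\<close> in its ball of half the radius.\<close>
      define p where "p x = (SOME y. y \<in> K \<inter> d.mball x (r / 2))" for x
      define L' where "L' = p ` {x \<in> L. K \<inter> d.mball x (r / 2) \<noteq> {}}"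
      have p: "p x \<in> K \<inter> d.mball x (r / 2)" if "K \<inter> d.mball x (r / 2) \<noteq> {}" for x
        using that unfolding p_def by (metis (no_types, lifting) equals0I someI_ex)
      have "K \<subseteq> (\<Union>y\<in>L'. d.mball y r)"
      proof
        fix z assume z: "z \<in> K"
        then obtain x where x: "x \<in> L" "z \<in> d.mball x (r / 2)" using L by auto
        then have ne: "K \<inter> d.mball x (r / 2) \<noteq> {}" using z by auto
        note px = p[OF ne]
        have "d (p x) z \<le> d (p x) x + d x z"
          using px x z KS L by (intro d.triangle) auto
        also have "\<dots> < r" using px x by (auto simp: d.commute)
        finally have "z \<in> d.mball (p x) r" using px z KS by auto
        then show "z \<in> (\<Union>y\<in>L'. d.mball y r)" unfolding L'_def using x ne by blast
      qed
      moreover have "finite L'" "L' \<subseteq> K" unfolding L'_def using L(1) p by auto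
      ultimately show "\<exists>L. finite L \<and> L \<subseteq> K \<and> K \<subseteq> (\<Union>x\<in>L. d.mball x r)" by blast
    qed
    then have "compactin \<tau> K"
      using d.mtotally_bounded_eq_compact_closure_of[OF S(2), of K] Kcl by (simp add: S(3) closure_of_closedin)
    moreover have "measure M (space M - K) < e"
    proof -
      have sm: "(\<lambda>i. e / 2 * (1/2) ^ Suc i) sums (e / 2 * 1)"
        using power_half_series by (intro sums_mult)
      have smm: "summable (\<lambda>i. measure M (space M - V (1 / Suc i) (n i)))"
        by (rule summable_comparison_test'[OF sums_summable[OF sm]]) (use n in \<open>auto simp: less_imp_le\<close>)
      have "space M - K = (\<Union>j. space M - V (1 / Suc j) (n j))" unfolding K_def by auto
      then have "measure M (space M - K) \<le> (\<Sum>i. measure M (space M - V (1 / Suc i) (n i)))"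
        using Vcl by (simp only:) (intro finite_measure_subadditive_countably smm, auto)
      also have "\<dots> \<le> e / 2 * 1"
        using sums_le[OF _ summable_sums[OF smm] sm] n by (auto simp: less_imp_le)
      finally show ?thesis using e by simp
    qed
    ultimately show ?thesis using that by blast
  qed
qed

section \<open>Equipartition trees\<close>

text \<open>Cells need not be closed, so nested cells may have empty intersection. Replacing each cell \<open>Q n k\<close>
  by a closed subset \<open>F n k\<close> costs an arbitrarily small total mass; on what remains of a compact set, cells
  and their closed subsets have the same trace, and nested nonempty traces have a common
  point by compactness.\<close>

lemma compact_cell_class:
  fixes Q :: "nat \<Rightarrow> nat \<Rightarrow> 'a set"
  assumes sb: "standard_borel M" and pm: "prob_space M" and part: "\<And>n. is_partition M (c n) (Q n)"
    and e: "e > 0"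
  obtains K where "K \<in> sets M" "measure M (space M - K) < e"
    "\<And>k. (\<And>n. k n < c n) \<Longrightarrow> (\<And>n. Q (Suc n) (k (Suc n)) \<subseteq> Q n (k n)) \<Longrightarrow>
       (\<And>n. K \<inter> Q n (k n) \<noteq> {}) \<Longrightarrow> (\<Inter>n. Q n (k n)) \<noteq> {}"
proof -
  interpret prob_space M by fact
  obtain \<tau> where gen: "polish_topology_generating \<tau> M"
    using sb by (auto simp: standard_borel_def)
  have cl[measurable]: "closedin \<tau> F \<Longrightarrow> F \<in> sets M" for F using generating_closed[OF gen] .
  have Qm[measurable]: "Q n k \<in> sets M" if "k < c n" for n k
    using part[of n] that by (auto simp: is_partition_def)
  have Qdisj: "Q n k \<inter> Q n l = {}" if "k < c n" "l < c n" "k \<noteq> l" for n k l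
    using part[of n] that by (auto simp: is_partition_def disjoint_family_on_def)
  have Qun: "(\<Union>k<c n. Q n k) = space M" for n
    using part[of n] by (auto simp: is_partition_def)
  obtain K0 where K0: "compactin \<tau> K0" "measure M (space M - K0) < e / 2"
    using compact_exhaustion[OF gen finite_measure_axioms, of "e / 2"] e by auto
  \<comment> \<open>Error per cell of level \<open>n\<close>: all levels together lose at most \<open>e / 2\<close>. The
    successor keeps the denominator positive.\<close>
  define \<delta> where "\<delta> n = e / 2 * (1/2) ^ Suc n / real (Suc (c n))" for n
  have \<delta>: "\<delta> n > 0" for n using e by (simp add: \<delta>_def)
  have "\<exists>F. closedin \<tau> F \<and> F \<subseteq> Q n k \<and> measure M (Q n k - F) < \<delta> n" if "k < c n" for n k
    using closed_inner_regular[OF gen finite_measure_axioms Qm[OF that] \<delta>[of n]] by metis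
  then have "\<exists>F. \<forall>n k. k < c n \<longrightarrow> closedin \<tau> (F n k) \<and> F n k \<subseteq> Q n k \<and> measure M (Q n k - F n k) < \<delta> n"
    by (intro exI[of _ "\<lambda>n k. SOME F. closedin \<tau> F \<and> F \<subseteq> Q n k \<and> measure M (Q n k - F) < \<delta> n"] allI impI)
       (rule someI_ex)
  then obtain F where F: "\<And>n k. k < c n \<Longrightarrow> closedin \<tau> (F n k)" "\<And>n k. k < c n \<Longrightarrow> F n k \<subseteq> Q n k"
      "\<And>n k. k < c n \<Longrightarrow> measure M (Q n k - F n k) < \<delta> n"
    by auto
  define G where "G n = (\<Union>k<c n. F n k)" for n
  have Gcl: "closedin \<tau> (G n)" for n
    unfolding G_def using F by (intro closedin_Union) auto
  have "polish_topology \<tau>" using gen by (simp add: polish_topology_generating_def)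
  then have "Hausdorff_space \<tau>"
    by (auto simp: polish_topology_def intro: completely_metrizable_imp_metrizable_space metrizable_imp_Hausdorff_space)
  then have K0cl: "closedin \<tau> K0" using K0(1) by (rule compactin_imp_closedin)
  define K where "K = K0 \<inter> (\<Inter>n. G n)"
  have Kcl: "closedin \<tau> K" unfolding K_def using Gcl K0cl by auto
  have Gmeas: "measure M (space M - G n) \<le> e / 2 * (1/2) ^ Suc n" for n
  proof -
    have "space M - G n \<subseteq> (\<Union>k<c n. Q n k - F n k)"
      unfolding Qun[of n, symmetric] G_def by auto
    then have "measure M (space M - G n) \<le> measure M (\<Union>k<c n. Q n k - F n k)"
      using F cl by (intro finite_measure_mono sets.finite_UN sets.Diff) auto
    also have "\<dots> \<le> (\<Sum>k<c n. measure M (Q n k - F n k))"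
      using F cl by (intro finite_measure_subadditive_finite) auto
    also have "\<dots> \<le> (\<Sum>k<c n. \<delta> n)"
      using F by (intro sum_mono) (auto intro: less_imp_le)
    also have "\<dots> \<le> real (Suc (c n)) * \<delta> n"
      using \<delta>[of n] by (simp add: distrib_right)
    also have "\<dots> = e / 2 * (1/2) ^ Suc n"
      by (simp add: \<delta>_def del: of_nat_Suc power_Suc)
    finally show ?thesis .
  qed
  have "measure M (space M - K) < e"
  proof -
    have sm: "(\<lambda>i. e / 2 * (1/2) ^ Suc i) sums (e / 2 * 1)"
      using power_half_series by (intro sums_mult)
    have smm: "summable (\<lambda>i. measure M (space M - G i))"
      by (rule summable_comparison_test'[OF sums_summable[OF sm]]) (use Gmeas in auto)
    have "measure M (space M - K) = measure M ((space M - K0) \<union> (\<Union>n. space M - G n))"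
      by (rule arg_cong[where f="measure M"]) (auto simp: K_def)
    also have "\<dots> \<le> measure M (space M - K0) + measure M (\<Union>n. space M - G n)"
      using Gcl K0cl by (intro measure_Un_le) auto
    also have "measure M (\<Union>n. space M - G n) \<le> (\<Sum>i. measure M (space M - G i))"
      using Gcl by (intro finite_measure_subadditive_countably smm) auto
    also have "\<dots> \<le> e / 2 * 1"
      using sums_le[OF _ summable_sums[OF smm] sm] Gmeas by auto
    finally show ?thesis using K0 by simp
  qed
  moreover have "(\<Inter>n. Q n (k n)) \<noteq> {}"
    if k: "\<And>n. k n < c n" and nest: "\<And>n. Q (Suc n) (k (Suc n)) \<subseteq> Q n (k n)"
      and ne: "\<And>n. K \<inter> Q n (k n) \<noteq> {}" for k
  proof -
    have eq: "K \<inter> Q n (k n) = K \<inter> F n (k n)" for n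
    proof
      show "K \<inter> F n (k n) \<subseteq> K \<inter> Q n (k n)" using F(2)[OF k] by auto
      show "K \<inter> Q n (k n) \<subseteq> K \<inter> F n (k n)"
      proof
        fix x assume x: "x \<in> K \<inter> Q n (k n)"
        then have "x \<in> G n" by (auto simp: K_def)
        then obtain j where j: "j < c n" "x \<in> F n j" by (auto simp: G_def)
        then have "x \<in> Q n j" using F(2) by auto
        then have "j = k n" using Qdisj[OF j(1) k[of n]] x by auto
        then show "x \<in> K \<inter> F n (k n)" using x j by auto
      qed
    qed
    have Ksub: "K \<subseteq> K0" by (auto simp: K_def)
    have comp: "compact_space (subtopology \<tau> K0)" using K0(1) by (simp add: compactin_subspace)
    have "(\<Inter>n. K \<inter> Q n (k n)) \<noteq> {}"
    proof (rule compact_space_imp_nest[OF comp])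
      show "closedin (subtopology \<tau> K0) (K \<inter> Q n (k n))" for n
        unfolding eq using Kcl F(1)[OF k] Ksub by (intro closedin_subset_topspace) auto
      show "K \<inter> Q n (k n) \<noteq> {}" for n by (rule ne)
      show "decseq (\<lambda>n. K \<inter> Q n (k n))" using nest by (intro decseq_SucI) auto
    qed
    then show ?thesis by auto
  qed
  ultimately show ?thesis using that[of K] cl[OF Kcl] by blast
qed

text \<open>The restriction of a segmentation to a divisibility chain \<open>c 0, c 1, \<dots>\<close> with quotients \<open>r n\<close>. The
  cells of level \<open>n + 1\<close> inside \<open>Q n i\<close> are those with indices \<open>i * r n, \<dots>, i * r n + r n - 1\<close>,
  so integer division by \<open>r n\<close> maps the index of a cell to that of its parent.\<close>

locale cell_tree = prob_space M for M :: "'a measure" +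
  fixes c r :: "nat \<Rightarrow> nat" and Q :: "nat \<Rightarrow> nat \<Rightarrow> 'a set"
  assumes c_pos: "c 0 > 0" and r_pos: "r n > 0" and c_Suc: "c (Suc n) = c n * r n"
    and part: "is_partition M (c n) (Q n)"
    and meas: "k < c n \<Longrightarrow> measure M (Q n k) = 1 / real (c n)"
    and refine: "k < c (Suc n) \<Longrightarrow> Q (Suc n) k \<subseteq> Q n (k div r n)"
    and generate: "sigma_sets (space M) (\<Union>n. Q n ` {..<c n}) = sets M"
begin

lemma c_gt_0 [simp]: "c n > 0"
  by (induction n) (use c_pos r_pos c_Suc in auto)

lemma parent_less: "k < c (Suc n) \<Longrightarrow> k div r n < c n"
  by (simp add: c_Suc r_pos less_mult_imp_div_less)

lemma cell_sets [measurable]: "k < c n \<Longrightarrow> Q n k \<in> sets M"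
  using part[of n] by (auto simp: is_partition_def)

lemma cell_disjoint: "k < c n \<Longrightarrow> l < c n \<Longrightarrow> x \<in> Q n k \<Longrightarrow> x \<in> Q n l \<Longrightarrow> k = l"
  using part[of n] by (auto simp: is_partition_def disjoint_family_on_def)

lemma cell_cover: "(\<Union>k<c n. Q n k) = space M"
  using part[of n] by (auto simp: is_partition_def)

lemma cell_nonempty: "k < c n \<Longrightarrow> Q n k \<noteq> {}"
  using meas[of k n] c_gt_0[of n] by (metis divide_eq_0_iff measure_empty of_nat_eq_0_iff less_irrefl zero_neq_one)

text \<open>The sequence \<open>code 0 x, code 1 x, \<dots>\<close> is the address of \<open>x\<close> in the tree; each entry
  determines the earlier ones.\<close>

definition code :: "nat \<Rightarrow> 'a \<Rightarrow> nat" where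
  "code n x = (THE k. k < c n \<and> x \<in> Q n k)"

lemma code_unique: "k < c n \<Longrightarrow> x \<in> Q n k \<Longrightarrow> code n x = k"
  unfolding code_def using cell_disjoint by blast

lemma code:
  assumes "x \<in> space M" shows "code n x < c n" "x \<in> Q n (code n x)"
proof -
  obtain k where "k < c n" "x \<in> Q n k" using assms cell_cover[of n] by auto
  then show "code n x < c n" "x \<in> Q n (code n x)" using code_unique by auto
qed

lemma code_Suc:
  assumes "x \<in> space M" shows "code n x = code (Suc n) x div r n"
  using code[OF assms, of "Suc n"] refine parent_less by (intro code_unique) auto

lemma cell_space: "k < c n \<Longrightarrow> Q n k \<subseteq> space M"
  using cell_cover[of n] by auto

lemma code_eq_coarser:
  assumes "m \<le> n" "x \<in> space M" "y \<in> space M" "code n x = code n y"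
  shows "code m x = code m y"
  using assms(1,4)
proof (induction n rule: dec_induct)
  case (step n)
  then show ?case using code_Suc[of x n] code_Suc[of y n] assms by simp
qed

lemma cell_nested:
  assumes "m \<le> n" "k < c m" "l < c n" "Q m k \<inter> Q n l \<noteq> {}"
  shows "Q n l \<subseteq> Q m k"
proof
  fix y assume y: "y \<in> Q n l"
  obtain x where x: "x \<in> Q m k" "x \<in> Q n l" using assms by auto
  have xy: "x \<in> space M" "y \<in> space M" using x y cell_space assms by auto
  have "code n x = code n y" using code_unique x y assms by auto
  from code_eq_coarser[OF assms(1) xy this] have "code m y = k"
    using code_unique[OF assms(2) x(1)] by simp
  then show "y \<in> Q m k" using code(2)[OF xy(2), of m] by simp
qed

text \<open>Two cells are nested or disjoint, whatever their levels.\<close>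

lemma Int_stable_cells: "Int_stable (insert {} (\<Union>n. Q n ` {..<c n}))"
proof -
  have *: "Q m k \<inter> Q n l \<in> insert {} (\<Union>n. Q n ` {..<c n})"
    if "m \<le> n" "k < c m" "l < c n" for m n k l
  proof (cases "Q m k \<inter> Q n l = {}")
    case False
    then have "Q m k \<inter> Q n l = Q n l" using cell_nested[OF that] by auto
    then show ?thesis using that by auto
  qed auto
  show ?thesis
    unfolding Int_stable_def
  proof (intro ballI)
    fix A B assume "A \<in> insert {} (\<Union>n. Q n ` {..<c n})" "B \<in> insert {} (\<Union>n. Q n ` {..<c n})"
    then consider "A = {} \<or> B = {}"
      | m n k l where "A = Q m k" "B = Q n l" "k < c m" "l < c n" by auto
    then show "A \<inter> B \<in> insert {} (\<Union>n. Q n ` {..<c n})"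
    proof cases
      case 2
      then show ?thesis using *[of m n k l] *[of n m l k] by (cases "m \<le> n") (auto simp: Int_commute)
    qed auto
  qed
qed

lemma generate_empty: "sigma_sets (space M) (insert {} (\<Union>n. Q n ` {..<c n})) = sets M"
proof
  have "insert {} (\<Union>n. Q n ` {..<c n}) \<subseteq> sets M" by auto
  then show "sigma_sets (space M) (insert {} (\<Union>n. Q n ` {..<c n})) \<subseteq> sets M"
    by (rule sets.sigma_sets_subset)
  show "sets M \<subseteq> sigma_sets (space M) (insert {} (\<Union>n. Q n ` {..<c n}))"
    unfolding generate[symmetric] by (intro sigma_sets_mono') auto
qed

text \<open>Two points with the same address lie in the same cells, hence in the same members of the generated
  \<open>\<sigma>\<close>-algebra; but singletons are closed and so belong to it.\<close>

lemma codes_separate: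
  assumes sb: "standard_borel M" and xy: "x \<in> space M" "y \<in> space M" and eq: "\<And>n. code n x = code n y"
  shows "x = y"
proof -
  have "x \<in> A \<longleftrightarrow> y \<in> A" if "A \<in> sets M" for A
    using that unfolding generate[symmetric]
  proof induction
    case (Basic A)
    then obtain n k where "A = Q n k" "k < c n" by auto
    then show ?case using code_unique code xy eq by metis
  qed (use xy in auto)
  moreover have "{x} \<in> sets M"
  proof -
    obtain \<tau> where gen: "polish_topology_generating \<tau> M"
      using sb by (auto simp: standard_borel_def)
    have "polish_topology \<tau>" using gen by (simp add: polish_topology_generating_def)
    then have "t1_space \<tau>"
      by (auto simp: polish_topology_def intro: completely_metrizable_imp_metrizable_space metrizable_imp_t1_space)
    then have "closedin \<tau> {x}"
      using xy generating_space[OF gen] by (simp add: closedin_t1_singleton)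
    then show ?thesis by (rule generating_closed[OF gen])
  qed
  ultimately show ?thesis by auto
qed

end

section \<open>Realising a permutation of cells by a measure-preserving map\<close>

context cell_tree begin

text \<open>The permutation of cells of level \<open>n\<close> that moves the cells of level \<open>0\<close> by \<open>\<sigma>\<close> and keeps the relative
  position inside each of them.\<close>

primrec target :: "(nat \<Rightarrow> nat) \<Rightarrow> nat \<Rightarrow> nat \<Rightarrow> nat" where
  "target \<sigma> 0 k = \<sigma> k"
| "target \<sigma> (Suc n) k = target \<sigma> n (k div r n) * r n + k mod r n"

lemma target_parent: "target \<sigma> (Suc n) k div r n = target \<sigma> n (k div r n)"
  using r_pos[of n] by simp

lemma target_bij:
  assumes "bij_betw \<sigma> {..<c 0} {..<c 0}"
  shows "bij_betw (target \<sigma> n) {..<c n} {..<c n}"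
proof (induction n)
  case 0
  then show ?case using assms by (simp add: bij_betw_def inj_on_def)
next
  case (Suc n)
  have "target \<sigma> (Suc n) k < c (Suc n)" if "k < c (Suc n)" for k
  proof -
    have "target \<sigma> n (k div r n) < c n"
      using bij_betw_apply[OF Suc] parent_less[OF that] by auto
    then have "Suc (target \<sigma> n (k div r n)) * r n \<le> c n * r n"
      by (intro mult_le_mono1) auto
    moreover have "k mod r n < r n" using r_pos by simp
    ultimately show ?thesis by (simp add: c_Suc)
  qed
  then have "target \<sigma> (Suc n) ` {..<c (Suc n)} \<subseteq> {..<c (Suc n)}" by blast
  moreover have "inj_on (target \<sigma> (Suc n)) {..<c (Suc n)}"
  proof (rule inj_onI)
    fix k l assume kl: "k \<in> {..<c (Suc n)}" "l \<in> {..<c (Suc n)}" "target \<sigma> (Suc n) k = target \<sigma> (Suc n) l"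
    then have "target \<sigma> n (k div r n) = target \<sigma> n (l div r n)"
      using target_parent by metis
    then have "k div r n = l div r n"
      using bij_betw_imp_inj_on[OF Suc] parent_less kl(1,2) by (auto dest!: inj_onD)
    moreover from this kl(3) have "k mod r n = l mod r n" by simp
    ultimately show "k = l" by (metis div_mult_mod_eq)
  qed
  ultimately show ?case
    unfolding bij_betw_def using endo_inj_surj by blast
qed

text \<open>The image of \<open>x\<close> is the point whose address at level \<open>n\<close> is \<open>target \<sigma> n (code n x)\<close>. It is unique by
  \<open>codes_separate\<close>, and it exists for almost every \<open>x\<close>: given \<open>K\<close> from \<open>compact_cell_class\<close>, the cells
  of level \<open>n\<close> whose target meets \<open>K\<close> are as many as the cells that meet \<open>K\<close>, so they have measure at least
  that of \<open>K\<close>, and this bound survives the decreasing limit over \<open>n\<close>. On the remaining null set the map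
  sends each cell to one chosen point of the target cell, which keeps the first entry of the address
  correct everywhere.\<close>

lemma realize_permutation:
  assumes sb: "standard_borel M" and \<sigma>: "bij_betw \<sigma> {..<c 0} {..<c 0}"
  obtains g where "g \<in> S_maps M" "\<And>k. k < c 0 \<Longrightarrow> g ` Q 0 k \<subseteq> Q 0 (\<sigma> k)"
proof -
  define t where "t = target \<sigma>"
  have t_bij: "bij_betw (t n) {..<c n} {..<c n}" for n
    unfolding t_def by (rule target_bij[OF \<sigma>])
  have t_less: "k < c n \<Longrightarrow> t n k < c n" for n k
    using bij_betw_apply[OF t_bij[of n], of k] by simp
  have t_inj: "k < c n \<Longrightarrow> l < c n \<Longrightarrow> t n k = t n l \<Longrightarrow> k = l" for n k l
    using bij_betw_imp_inj_on[OF t_bij[of n]] by (auto dest: inj_onD)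
  have t_surj: "\<exists>i<c n. t n i = j" if "j < c n" for n j
    using bij_betw_imp_surj_on[OF t_bij[of n]] that by (metis imageE lessThan_iff)
  have nest: "Q (Suc n) (t (Suc n) k) \<subseteq> Q n (t n (k div r n))" if "k < c (Suc n)" for n k
    using refine[OF t_less[OF that]] target_parent[of \<sigma> n k] unfolding t_def by simp
  have nest_code: "Q (Suc n) (t (Suc n) (code (Suc n) x)) \<subseteq> Q n (t n (code n x))"
    if "x \<in> space M" for n x
    using nest[OF code(1)[OF that, of "Suc n"]] code_Suc[OF that, of n] by simp
  define D where "D K = {x \<in> space M. \<forall>n. K \<inter> Q n (t n (code n x)) \<noteq> {}}" for K
  have D: "D K \<in> sets M" "measure M K \<le> measure M (D K)" if K: "K \<in> sets M" for K
  proof -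
    define I where "I n = {k. k < c n \<and> K \<inter> Q n (t n k) \<noteq> {}}" for n
    have fin: "finite (I n)" for n unfolding I_def by simp
    have I: "k \<in> I n \<Longrightarrow> k < c n" for k n unfolding I_def by simp
    define L where "L n = (\<Union>k\<in>I n. Q n k)" for n
    have Lm: "L n \<in> sets M" for n
      unfolding L_def using fin I by (intro sets.finite_UN) auto
    have xL: "x \<in> L n \<longleftrightarrow> x \<in> space M \<and> K \<inter> Q n (t n (code n x)) \<noteq> {}" for x n
    proof
      assume "x \<in> L n"
      then obtain k where k: "k \<in> I n" "x \<in> Q n k" by (auto simp: L_def)
      then show "x \<in> space M \<and> K \<inter> Q n (t n (code n x)) \<noteq> {}"
        using cell_space[OF I] code_unique[OF I[OF k(1)] k(2)] unfolding I_def by auto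
    next
      assume x: "x \<in> space M \<and> K \<inter> Q n (t n (code n x)) \<noteq> {}"
      then have "code n x \<in> I n" "x \<in> Q n (code n x)" using code[of x n] by (auto simp: I_def)
      then show "x \<in> L n" unfolding L_def by blast
    qed
    have DL: "D K = (\<Inter>n. L n)"
      unfolding D_def using xL by auto
    then show "D K \<in> sets M" using Lm by auto
    have "decseq L"
    proof (rule decseq_SucI, rule subsetI)
      fix n x assume "x \<in> L (Suc n)"
      then show "x \<in> L n" using nest_code[of x n] unfolding xL by blast
    qed
    then have lim: "(\<lambda>n. measure M (L n)) \<longlonglongrightarrow> measure M (D K)"
      unfolding DL using Lm by (intro finite_Lim_measure_decseq) auto
    have "measure M K \<le> measure M (L n)" for n
    proof -
      have "K \<subseteq> (\<Union>k\<in>I n. Q n (t n k))"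
      proof
        fix x assume x: "x \<in> K"
        then have xs: "x \<in> space M" using sets.sets_into_space[OF K] by auto
        obtain i where i: "i < c n" "t n i = code n x" using t_surj code(1)[OF xs] by blast
        then have "i \<in> I n" using x code(2)[OF xs, of n] unfolding I_def by auto
        then show "x \<in> (\<Union>k\<in>I n. Q n (t n k))"
          using i code(2)[OF xs, of n] by (intro UN_I[of i]) auto
      qed
      then have "measure M K \<le> measure M (\<Union>k\<in>I n. Q n (t n k))"
        using fin I t_less by (intro finite_measure_mono sets.finite_UN) auto
      also have "\<dots> \<le> (\<Sum>k\<in>I n. measure M (Q n (t n k)))"
        using fin I t_less by (intro finite_measure_subadditive_finite) auto
      also have "\<dots> = (\<Sum>k\<in>I n. measure M (Q n k))"
        using I t_less by (intro sum.cong) (auto simp: meas)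
      also have "\<dots> = measure M (L n)"
        unfolding L_def using fin I
        by (intro finite_measure_finite_Union[symmetric])
           (auto simp: disjoint_family_on_def dest: cell_disjoint[OF I I])
      finally show ?thesis .
    qed
    then show "measure M K \<le> measure M (D K)"
      by (intro LIMSEQ_le_const[OF lim]) auto
  qed
  have "\<exists>K. K \<in> sets M \<and> measure M (space M - K) < 1 / real (Suc m) \<and>
      (\<forall>k. (\<forall>n. k n < c n) \<longrightarrow> (\<forall>n. Q (Suc n) (k (Suc n)) \<subseteq> Q n (k n)) \<longrightarrow>
         (\<forall>n. K \<inter> Q n (k n) \<noteq> {}) \<longrightarrow> (\<Inter>n. Q n (k n)) \<noteq> {})" for m
  proof -
    have "1 / real (Suc m) > 0" by simp
    then show ?thesis
    proof (rule compact_cell_class[OF sb prob_space_axioms part])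
      fix K assume K: "K \<in> sets M" "measure M (space M - K) < 1 / real (Suc m)"
        "\<And>k. (\<And>n. k n < c n) \<Longrightarrow> (\<And>n. Q (Suc n) (k (Suc n)) \<subseteq> Q n (k n)) \<Longrightarrow>
           (\<And>n. K \<inter> Q n (k n) \<noteq> {}) \<Longrightarrow> (\<Inter>n. Q n (k n)) \<noteq> {}"
      show ?thesis by (intro exI[of _ K] conjI allI impI K) simp_all
    qed
  qed
  then obtain K where K: "\<And>m. K m \<in> sets M" "\<And>m. measure M (space M - K m) < 1 / real (Suc m)"
     and Kne: "\<And>m k. \<forall>n. k n < c n \<Longrightarrow> \<forall>n. Q (Suc n) (k (Suc n)) \<subseteq> Q n (k n) \<Longrightarrow>
         \<forall>n. K m \<inter> Q n (k n) \<noteq> {} \<Longrightarrow> (\<Inter>n. Q n (k n)) \<noteq> {}"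
    by metis
  define E where "E = (\<Union>m. D (K m))"
  have Em[measurable]: "E \<in> sets M" unfolding E_def using D(1) K(1) by auto
  have Esp: "E \<subseteq> space M" using sets.sets_into_space[OF Em] .
  have E1: "measure M E = 1"
  proof -
    have "1 - measure M E \<le> 1 / real (Suc m)" for m
    proof -
      have "measure M (K m) \<le> measure M (D (K m))" using D K by blast
      also have "\<dots> \<le> measure M E" using D K Em by (intro finite_measure_mono) (auto simp: E_def)
      finally show ?thesis using K[of m] prob_compl[OF K(1)[of m]] by simp
    qed
    moreover have "(\<lambda>m. 1 / real (Suc m)) \<longlonglongrightarrow> 0"
      using LIMSEQ_inverse_real_of_nat by (simp add: inverse_eq_divide)
    ultimately have "1 - measure M E \<le> 0"
      by (intro LIMSEQ_le_const) auto
    then show ?thesis using prob_le_1[of E] by simp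
  qed
  have Ene: "(\<Inter>n. Q n (t n (code n x))) \<noteq> {}" if x: "x \<in> E" for x
  proof -
    have xs: "x \<in> space M" using x Esp by auto
    obtain m where "x \<in> D (K m)" using x unfolding E_def by auto
    then have "\<forall>n. K m \<inter> Q n (t n (code n x)) \<noteq> {}" unfolding D_def by simp
    from Kne[of "\<lambda>n. t n (code n x)", OF _ _ this] show ?thesis
      using t_less code(1)[OF xs] nest_code[OF xs] by simp
  qed
  define p where "p k = (SOME y. y \<in> Q 0 k)" for k
  have p: "p k \<in> Q 0 k" if "k < c 0" for k
    unfolding p_def using cell_nonempty[OF that] by (rule some_in_eq[THEN iffD2])
  define g where "g x = (if x \<in> E then SOME y. y \<in> (\<Inter>n. Q n (t n (code n x))) else p (\<sigma> (code 0 x)))" for x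
  have gE: "g x \<in> Q n (t n (code n x))" if "x \<in> E" for x n
    using some_in_eq[THEN iffD2, OF Ene[OF that]] that unfolding g_def by auto
  have gcode: "code n (g x) = t n (code n x)" if "x \<in> E" for x n
    using gE[OF that] t_less code(1) that Esp by (intro code_unique) auto
  have g0: "g x \<in> Q 0 (\<sigma> (code 0 x))" if "x \<in> space M" for x
  proof (cases "x \<in> E")
    case True
    then show ?thesis using gE[of x 0] by (simp add: t_def)
  next
    case False
    then show ?thesis using p[OF t_less[OF code(1)[OF that, of 0]]] by (simp add: g_def t_def)
  qed
  have gsp: "g x \<in> space M" if "x \<in> space M" for x
    using g0[OF that] cell_space[OF t_less[OF code(1)[OF that, of 0]]] by (auto simp: t_def)
  have g_mem: "g x \<in> Q n (t n i) \<longleftrightarrow> x \<in> Q n i" if "x \<in> E" "i < c n" for x n i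
  proof -
    have xs: "x \<in> space M" using that Esp by auto
    have "g x \<in> Q n (t n i) \<longleftrightarrow> code n (g x) = t n i"
      using code_unique code(2)[OF gsp[OF xs]] t_less[OF that(2)] by metis
    also have "\<dots> \<longleftrightarrow> code n x = i"
      using gcode[OF that(1)] t_inj[OF code(1)[OF xs] that(2)] by auto
    also have "\<dots> \<longleftrightarrow> x \<in> Q n i"
      using code_unique code(2)[OF xs] that(2) by metis
    finally show ?thesis .
  qed
  have gm: "g \<in> M \<rightarrow>\<^sub>M M"
  proof (rule measurable_sigma_sets[OF generate[symmetric]])
    show "(\<Union>n. Q n ` {..<c n}) \<subseteq> Pow (space M)" using cell_space by auto
    show "g \<in> space M \<rightarrow> space M" using gsp by auto
    fix B assume "B \<in> (\<Union>n. Q n ` {..<c n})"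
    then obtain n i where i: "i < c n" "B = Q n (t n i)" using t_surj by blast
    let ?J = "{k. k < c 0 \<and> p (\<sigma> k) \<in> B}"
    have "g -` B \<inter> space M = (E \<inter> Q n i) \<union> ((\<Union>k\<in>?J. Q 0 k) - E)" (is "?l = ?r")
    proof (rule set_eqI)
      fix x
      show "x \<in> ?l \<longleftrightarrow> x \<in> ?r"
      proof (cases "x \<in> E")
        case True
        then show ?thesis using g_mem[OF True i(1)] Esp i(2) by auto
      next
        case False
        have "x \<in> (\<Union>k\<in>?J. Q 0 k) \<longleftrightarrow> x \<in> space M \<and> p (\<sigma> (code 0 x)) \<in> B"
        proof
          assume "x \<in> (\<Union>k\<in>?J. Q 0 k)"
          then obtain k where "k < c 0" "p (\<sigma> k) \<in> B" "x \<in> Q 0 k" by auto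
          then show "x \<in> space M \<and> p (\<sigma> (code 0 x)) \<in> B"
            using code_unique[of k 0 x] cell_space[of k 0] by auto
        next
          assume "x \<in> space M \<and> p (\<sigma> (code 0 x)) \<in> B"
          then show "x \<in> (\<Union>k\<in>?J. Q 0 k)" using code[of x 0] by auto
        qed
        then show ?thesis using False by (auto simp: g_def)
      qed
    qed
    moreover have "(\<Union>k\<in>?J. Q 0 k) \<in> sets M" by (intro sets.finite_UN) auto
    ultimately show "g -` B \<inter> space M \<in> sets M" using i by auto
  qed
  have AE_E: "AE x in M. x \<in> E" using E1 Em prob_eq_1 by blast
  have "distr M M g = M"
  proof (rule measure_eqI_generator_eq_countable[OF Int_stable_cells, where \<Omega>="space M" and A="Q 0 ` {..<c 0}"])
    show "insert {} (\<Union>n. Q n ` {..<c n}) \<subseteq> Pow (space M)" using cell_space by auto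
    show "sets (distr M M g) = sigma_sets (space M) (insert {} (\<Union>n. Q n ` {..<c n}))"
      by (simp add: generate_empty)
    show "sets M = sigma_sets (space M) (insert {} (\<Union>n. Q n ` {..<c n}))"
      by (simp add: generate_empty)
    show "\<Union> (Q 0 ` {..<c 0}) = space M" using cell_cover .
    fix X assume "X \<in> insert {} (\<Union>n. Q n ` {..<c n})"
    then consider "X = {}" | n i where "i < c n" "X = Q n (t n i)" using t_surj by blast
    then show "emeasure (distr M M g) X = emeasure M X"
    proof cases
      case 2
      have "AE x in M. x \<in> g -` X \<inter> space M \<longleftrightarrow> x \<in> Q n i"
        using AE_E g_mem 2 Esp by (auto elim!: eventually_mono)
      then have "measure M (g -` X \<inter> space M) = measure M (Q n i)"
        using 2 gm t_less[OF 2(1)] by (intro finite_measure_eq_AE) (auto intro!: measurable_sets)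
      also have "\<dots> = measure M X" using 2 t_less by (simp add: meas)
      finally show ?thesis
        using 2 gm t_less[OF 2(1)] by (simp add: emeasure_distr emeasure_eq_measure)
    qed simp
  qed (use finite_measure.emeasure_finite[OF finite_measure_distr[OF gm]] in auto)
  moreover have "essentially_injective M g"
    unfolding essentially_injective_def
  proof (intro bexI[OF _ Em] conjI)
    show "emeasure M (space M - E) = 0"
      using E1 prob_compl[OF Em] by (simp add: emeasure_eq_measure)
    show "inj_on g E"
    proof (rule inj_onI)
      fix x y assume xy: "x \<in> E" "y \<in> E" "g x = g y"
      then have "t n (code n x) = t n (code n y)" for n using gcode by metis
      then have "code n x = code n y" for n
        using t_inj code(1) xy Esp by blast
      then show "x = y" using codes_separate[OF sb] xy Esp by auto
    qed
  qed
  ultimately have "g \<in> S_maps M" using gm by (simp add: S_maps_def)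
  moreover have "g ` Q 0 k \<subseteq> Q 0 (\<sigma> k)" if "k < c 0" for k
    using g0 code_unique[OF that] cell_space[OF that] by auto
  ultimately show ?thesis using that by blast
qed

end

section \<open>Permutations with prescribed block counts\<close>

text \<open>Greedy matching: while some \<open>b i j\<close> is positive, the hypotheses provide a source in block \<open>i\<close> and a
  destination in block \<open>j\<close>; match them, remove both and lower \<open>b i j\<close> by one. Equality of the
  cardinalities allows the leftover elements to be matched arbitrarily.\<close>

lemma bij_with_block_counts:
  fixes b :: "'i \<Rightarrow> 'i \<Rightarrow> nat" and \<rho> :: "'x \<Rightarrow> 'i"
  assumes "finite X" "finite Y" "card X = card Y" and I: "finite I"
    and "\<And>i. i \<in> I \<Longrightarrow> (\<Sum>j\<in>I. b i j) \<le> card {x \<in> X. \<rho> x = i}"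
    and "\<And>j. j \<in> I \<Longrightarrow> (\<Sum>i\<in>I. b i j) \<le> card {y \<in> Y. \<rho> y = j}"
  shows "\<exists>\<sigma>. bij_betw \<sigma> X Y \<and> (\<forall>i\<in>I. \<forall>j\<in>I. b i j \<le> card {x \<in> X. \<rho> x = i \<and> \<rho> (\<sigma> x) = j})"
  using assms(1,2,3,5,6)
proof (induction "\<Sum>i\<in>I. \<Sum>j\<in>I. b i j" arbitrary: X Y b)
  case 0
  then have "\<forall>i\<in>I. \<forall>j\<in>I. b i j = 0" using I by (auto simp: sum_eq_0_iff)
  moreover obtain \<sigma> where "bij_betw \<sigma> X Y"
    using finite_same_card_bij[OF 0(2,3,4)] by auto
  ultimately show ?case by (intro exI[of _ \<sigma>]) auto
next
  case (Suc s)
  have "\<exists>i\<in>I. \<exists>j\<in>I. b i j > 0"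
  proof (rule ccontr)
    assume "\<not> ?thesis"
    then have "(\<Sum>i\<in>I. \<Sum>j\<in>I. b i j) = 0" by (intro sum.neutral ballI) auto
    then show False using Suc(2) by simp
  qed
  then obtain i j where ij: "i \<in> I" "j \<in> I" "b i j > 0" by blast
  define b' where "b' i' j' = (if i' = i \<and> j' = j then b i j - 1 else b i' j')" for i' j'
  have b_eq: "b i' j' = b' i' j' + (if i' = i \<and> j' = j then 1 else 0)" for i' j'
    using ij by (simp add: b'_def)
  have row: "(\<Sum>j'\<in>I. b i' j') = (\<Sum>j'\<in>I. b' i' j') + (if i' = i then 1 else 0)" for i'
    using ij I by (simp add: b_eq sum.distrib sum.delta)
  have col: "(\<Sum>i'\<in>I. b i' j') = (\<Sum>i'\<in>I. b' i' j') + (if j' = j then 1 else 0)" for j'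
    using ij I by (simp add: b_eq sum.distrib sum.delta)
  have tot: "s = (\<Sum>i'\<in>I. \<Sum>j'\<in>I. b' i' j')"
    using Suc(2) ij I by (simp add: row sum.distrib sum.delta)
  have "card {x \<in> X. \<rho> x = i} > 0" using Suc(6)[OF ij(1)] row[of i] by simp
  then have "{x \<in> X. \<rho> x = i} \<noteq> {}" by (auto simp only: card_gt_0_iff)
  then obtain x where x: "x \<in> X" "\<rho> x = i" by auto
  have "card {y \<in> Y. \<rho> y = j} > 0" using Suc(7)[OF ij(2)] col[of j] by simp
  then have "{y \<in> Y. \<rho> y = j} \<noteq> {}" by (auto simp only: card_gt_0_iff)
  then obtain y where y: "y \<in> Y" "\<rho> y = j" by auto
  have cardX: "card {x' \<in> X - {x}. \<rho> x' = i'} + (if i' = i then 1 else 0) = card {x' \<in> X. \<rho> x' = i'}" for i'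
  proof (cases "i' = i")
    case True
    have "{x' \<in> X. \<rho> x' = i'} = insert x {x' \<in> X - {x}. \<rho> x' = i'}" using x True by auto
    then show ?thesis using True Suc(3) by simp
  next
    case False
    then have "{x' \<in> X. \<rho> x' = i'} = {x' \<in> X - {x}. \<rho> x' = i'}" using x by auto
    then show ?thesis using False by simp
  qed
  have cardY: "card {y' \<in> Y - {y}. \<rho> y' = j'} + (if j' = j then 1 else 0) = card {y' \<in> Y. \<rho> y' = j'}" for j'
  proof (cases "j' = j")
    case True
    have "{y' \<in> Y. \<rho> y' = j'} = insert y {y' \<in> Y - {y}. \<rho> y' = j'}" using y True by auto
    then show ?thesis using True Suc(4) by simp
  next
    case False
    then have "{y' \<in> Y. \<rho> y' = j'} = {y' \<in> Y - {y}. \<rho> y' = j'}" using y by auto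
    then show ?thesis using False by simp
  qed
  have "\<exists>\<sigma>. bij_betw \<sigma> (X - {x}) (Y - {y}) \<and>
     (\<forall>i\<in>I. \<forall>j\<in>I. b' i j \<le> card {x' \<in> X - {x}. \<rho> x' = i \<and> \<rho> (\<sigma> x') = j})"
  proof (rule Suc(1)[OF tot])
    show "(\<Sum>j\<in>I. b' i' j) \<le> card {x' \<in> X - {x}. \<rho> x' = i'}" if "i' \<in> I" for i'
      using Suc(6)[OF that] unfolding row cardX[symmetric] by (simp split: if_splits)
    show "(\<Sum>i\<in>I. b' i j') \<le> card {y' \<in> Y - {y}. \<rho> y' = j'}" if "j' \<in> I" for j'
      using Suc(7)[OF that] unfolding col cardY[symmetric] by (simp split: if_splits)
  qed (use Suc x y in auto)
  then obtain \<sigma> where \<sigma>: "bij_betw \<sigma> (X - {x}) (Y - {y})"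
     "\<And>i j. i \<in> I \<Longrightarrow> j \<in> I \<Longrightarrow> b' i j \<le> card {x' \<in> X - {x}. \<rho> x' = i \<and> \<rho> (\<sigma> x') = j}" by blast
  let ?\<sigma> = "\<sigma>(x := y)"
  have "bij_betw ?\<sigma> (X - {x}) (Y - {y})"
    using \<sigma>(1) by (rule bij_betw_cong[THEN iffD1, rotated]) auto
  moreover have "bij_betw ?\<sigma> {x} {y}" by (simp add: bij_betw_def)
  ultimately have "bij_betw ?\<sigma> ((X - {x}) \<union> {x}) ((Y - {y}) \<union> {y})"
    by (intro bij_betw_combine) auto
  then have "bij_betw ?\<sigma> X Y" using x y by (simp add: insert_absorb)
  moreover have "b i' j' \<le> card {x' \<in> X. \<rho> x' = i' \<and> \<rho> (?\<sigma> x') = j'}" if "i' \<in> I" "j' \<in> I" for i' j'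
  proof -
    let ?S = "{x' \<in> X - {x}. \<rho> x' = i' \<and> \<rho> (\<sigma> x') = j'}"
    have "{x' \<in> X. \<rho> x' = i' \<and> \<rho> (?\<sigma> x') = j'} = (if i' = i \<and> j' = j then insert x ?S else ?S)"
      using x y by auto
    moreover have "card (insert x ?S) = Suc (card ?S)"
      using Suc(3) by (intro card_insert_disjoint) auto
    ultimately have "card {x' \<in> X. \<rho> x' = i' \<and> \<rho> (?\<sigma> x') = j'} = card ?S + (if i' = i \<and> j' = j then 1 else 0)"
      by (simp only: if_distrib[of card] split: if_split) simp
    then show ?thesis
      using \<sigma>(2)[OF that] unfolding b_eq[of i' j'] by linarith
  qed
  ultimately show ?case by blast
qed

section \<open>From a segmentation to an equipartition tree\<close>

text \<open>The index set is countable and directed, so it has a cofinal divisibility chain; unboundedness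
  allows its growth to be prescribed.\<close>

lemma index_chain:
  assumes "dvd_directed_index_set NN"
  obtains c where "\<And>n. c n \<in> NN" "\<And>n. c n dvd c (Suc n)" "\<And>n. c n < c (Suc n)"
    "\<And>n. Suc n * (c n)\<^sup>2 \<le> c (Suc n)" "\<And>N. N \<in> NN \<Longrightarrow> \<exists>n. N dvd c n"
proof -
  have pos: "N > 0" if "N \<in> NN" for N
    using assms that by (auto simp: dvd_directed_index_set_def)
  have big: "\<exists>N\<in>NN. N > b" for b
    using assms unfolding dvd_directed_index_set_def bdd_above_def by (meson not_le)
  have dir: "\<exists>K\<in>NN. L dvd K \<and> N dvd K" if "L \<in> NN" "N \<in> NN" for L N
    using assms that by (auto simp: dvd_directed_index_set_def)
  have ne: "NN \<noteq> {}" using big by blast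
  define e where "e = from_nat_into NN"
  have e: "range e = NN" unfolding e_def using ne by (intro range_from_nat_into) auto
  then have eN: "e n \<in> NN" for n by auto
  have "\<exists>c. \<forall>n. c n \<in> NN \<and> (c n dvd c (Suc n) \<and> e n dvd c (Suc n) \<and> c n < c (Suc n) \<and> Suc n * (c n)\<^sup>2 \<le> c (Suc n))"
  proof (rule dependent_nat_choice)
    show "\<exists>x. x \<in> NN" using ne by blast
    fix m n assume m: "m \<in> NN"
    obtain L where L: "L \<in> NN" "m dvd L" "e n dvd L" using dir[OF m eN] by blast
    obtain B where B: "B \<in> NN" "B > m + Suc n * m\<^sup>2" using big by blast
    obtain K where K: "K \<in> NN" "L dvd K" "B dvd K" using dir[OF L(1) B(1)] by blast
    have "B \<le> K" using K pos by (intro dvd_imp_le) auto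
    then have "m < K" "Suc n * m\<^sup>2 \<le> K" using B by auto
    then show "\<exists>y. y \<in> NN \<and> m dvd y \<and> e n dvd y \<and> m < y \<and> Suc n * m\<^sup>2 \<le> y"
      using K L by (intro exI[of _ K]) (auto intro: dvd_trans)
  qed
  then obtain c where c: "\<And>n. c n \<in> NN" "\<And>n. c n dvd c (Suc n)" "\<And>n. e n dvd c (Suc n)"
      "\<And>n. c n < c (Suc n)" "\<And>n. Suc n * (c n)\<^sup>2 \<le> c (Suc n)" by blast
  moreover have "\<exists>n. N dvd c n" if "N \<in> NN" for N using that e c(3) by blast
  ultimately show ?thesis using that by blast
qed

text \<open>Since the chain is cofinal, each cell of the segmentation is a finite union of cells of the
  chain, so the chain alone already generates the \<open>\<sigma>\<close>-algebra.\<close>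

lemma segmentation_cell_tree:
  assumes "prob_space M" and seg: "segmentation NN M P"
    and pos: "\<And>N. N \<in> NN \<Longrightarrow> N > 0"
    and c: "\<And>n. c n \<in> NN" "\<And>n. c n dvd c (Suc n)" "\<And>N. N \<in> NN \<Longrightarrow> \<exists>n. N dvd c n"
  shows "cell_tree M c (\<lambda>n. c (Suc n) div c n) (\<lambda>n. P (c n))"
proof -
  interpret prob_space M by fact
  have cpos: "c n > 0" for n using pos c by auto
  have part: "is_partition M N (P N)" if "N \<in> NN" for N
    using seg that by (auto simp: segmentation_def)
  have ref: "(\<Union>k<K. P (K * N) (m * K + k)) = P N m" if "N \<in> NN" "K * N \<in> NN" "m < N" for N K m
    using seg that by (auto simp: segmentation_def)
  have gen: "sigma_sets (space M) (\<Union>N\<in>NN. sets (partition_algebra M P N)) = sets M"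
    using seg by (auto simp: segmentation_def)
  let ?G = "\<Union>n. P (c n) ` {..<c n}"
  have Gs: "?G \<subseteq> sets M" using part[OF c(1)] by (auto simp: is_partition_def)
  have sub: "sets (partition_algebra M P N) \<subseteq> sigma_sets (space M) ?G" if N: "N \<in> NN" for N
  proof -
    obtain n where "N dvd c n" using c(3)[OF N] by blast
    then obtain K where K: "c n = K * N" by (metis dvd_def mult.commute)
    have "P N m \<in> sigma_sets (space M) ?G" if m: "m < N" for m
    proof -
      have "m * K + k < c n" if "k < K" for k
      proof -
        have "m * K + k < Suc m * K" using that by simp
        also have "\<dots> \<le> N * K" using m by (intro mult_le_mono1) auto
        finally show ?thesis by (simp add: K mult.commute)
      qed
      then have "P (c n) (m * K + k) \<in> sigma_sets (space M) ?G" if "k < K" for k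
        using that by (intro sigma_sets.Basic) blast
      moreover have "P N m = (\<Union>k\<in>{..<K}. P (c n) (m * K + k))"
        using ref[OF N _ m, of K] K c(1)[of n] by simp
      ultimately show ?thesis
        using sets.finite_UN[of "{..<K}" "\<lambda>k. P (c n) (m * K + k)" "sigma (space M) ?G"] Gs sets.space_closed[of M]
        by (simp add: subset_trans sets_measure_of)
    qed
    moreover have "P N ` {..<N} \<subseteq> Pow (space M)"
      using part[OF N] sets.sets_into_space by (auto simp: is_partition_def)
    ultimately show ?thesis
      unfolding partition_algebra_def by (auto intro!: sigma_sets_mono)
  qed
  show ?thesis
  proof
    show "c 0 > 0" by (rule cpos)
    show "c (Suc n) div c n > 0" for n
      using c(2)[of n] cpos[of "Suc n"] cpos[of n] by (auto simp: div_greater_zero_iff intro: dvd_imp_le)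
    show cS: "c (Suc n) = c n * (c (Suc n) div c n)" for n using c(2) by simp
    show "is_partition M (c n) (P (c n))" for n using part c by auto
    show "k < c n \<Longrightarrow> prob (P (c n) k) = 1 / real (c n)" for k n
      using seg c(1)[of n] by (auto simp: segmentation_def prob_space)
    show "P (c (Suc n)) k \<subseteq> P (c n) (k div (c (Suc n) div c n))" if "k < c (Suc n)" for n k
    proof -
      let ?K = "c (Suc n) div c n"
      have K: "c (Suc n) = ?K * c n" using c(2) by simp
      have K0: "?K > 0" using K cpos[of "Suc n"] by (metis mult_is_0 neq0_conv)
      have "k div ?K < c n" using that K by (metis less_mult_imp_div_less mult.commute)
      from ref[OF c(1) _ this, of ?K] K c(1)[of "Suc n"]
      have eq: "(\<Union>j<?K. P (c (Suc n)) (k div ?K * ?K + j)) = P (c n) (k div ?K)" by simp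
      have "P (c (Suc n)) (k div ?K * ?K + k mod ?K) \<subseteq> (\<Union>j<?K. P (c (Suc n)) (k div ?K * ?K + j))"
        using K0 by (intro UN_upper) auto
      then show ?thesis unfolding eq div_mult_mod_eq .
    qed
    show "sigma_sets (space M) ?G = sets M"
    proof
      show "sigma_sets (space M) ?G \<subseteq> sets M" using Gs by (rule sets.sigma_sets_subset)
      have "(\<Union>N\<in>NN. sets (partition_algebra M P N)) \<subseteq> sigma_sets (space M) ?G" using sub by auto
      then show "sets M \<subseteq> sigma_sets (space M) ?G"
        unfolding gen[symmetric] by (rule sigma_sets_mono)
    qed
  qed
qed

context cell_tree begin

lemma cell_eq_Union:
  assumes "m \<le> n" "i < c m"
  shows "Q m i = (\<Union>k\<in>{k. k < c n \<and> Q n k \<subseteq> Q m i}. Q n k)"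
proof
  show "Q m i \<subseteq> (\<Union>k\<in>{k. k < c n \<and> Q n k \<subseteq> Q m i}. Q n k)"
  proof
    fix x assume x: "x \<in> Q m i"
    then have "x \<in> space M" using cell_space[OF assms(2)] by auto
    note cx = code[OF this, of n]
    have "Q n (code n x) \<subseteq> Q m i" using cell_nested[OF assms cx(1)] x cx by blast
    then show "x \<in> (\<Union>k\<in>{k. k < c n \<and> Q n k \<subseteq> Q m i}. Q n k)" using cx by blast
  qed
qed auto

text \<open>Dropping the first levels leaves an equipartition tree, so that results about permutations of the
  coarsest level apply to every level.\<close>

lemma shift: "cell_tree M (\<lambda>k. c (n + k)) (\<lambda>k. r (n + k)) (\<lambda>k. Q (n + k))"
proof
  let ?G = "\<Union>k. Q (n + k) ` {..<c (n + k)}"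
  have G: "?G \<subseteq> sets M" by auto
  show "sigma_sets (space M) ?G = sets M"
  proof
    show "sigma_sets (space M) ?G \<subseteq> sets M" using G by (rule sets.sigma_sets_subset)
    have "Q m i \<in> sigma_sets (space M) ?G" if "i < c m" for m i
    proof -
      have "Q (n + m) k \<in> sigma_sets (space M) ?G" if "k < c (n + m)" for k
        using that by (intro sigma_sets.Basic) blast
      then have "(\<Union>k\<in>{k. k < c (n + m) \<and> Q (n + m) k \<subseteq> Q m i}. Q (n + m) k) \<in> sigma_sets (space M) ?G"
        using sets.finite_UN[of "{k. k < c (n + m) \<and> Q (n + m) k \<subseteq> Q m i}" "Q (n + m)" "sigma (space M) ?G"]
          G sets.space_closed[of M] by (simp add: subset_trans sets_measure_of)
      then show ?thesis using cell_eq_Union[OF _ that, of "n + m"] by simp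
    qed
    then show "sets M \<subseteq> sigma_sets (space M) ?G"
      unfolding generate[symmetric] by (intro sigma_sets_mono) auto
  qed
qed (use c_gt_0 r_pos c_Suc part meas refine in auto)

end

section \<open>Convergence of couplings on measurable rectangles\<close>

text \<open>Dynkin's \<open>\<pi>\<close>-\<open>\<lambda>\<close> argument. Setwise limits need not be compatible with countable disjoint unions in
  general; the common bound by \<open>P\<close> makes them so, through Tannery's theorem.\<close>

lemma setwise_convergence_from_generator:
  assumes N: "\<And>n. finite_measure (N n)" "\<And>n. sets (N n) = sets P"
    and L: "finite_measure L" "sets L = sets P" and P: "finite_measure P"
    and G: "Int_stable G" "G \<subseteq> Pow (space P)" "sigma_sets (space P) G = sets P"
    and dom: "\<And>n A. A \<in> sets P \<Longrightarrow> measure (N n) A \<le> measure P A"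
    and basic: "\<And>A. A \<in> G \<Longrightarrow> (\<lambda>n. measure (N n) A) \<longlonglongrightarrow> measure L A"
    and top: "(\<lambda>n. measure (N n) (space P)) \<longlonglongrightarrow> measure L (space P)"
    and A: "A \<in> sets P"
  shows "(\<lambda>n. measure (N n) A) \<longlonglongrightarrow> measure L A"
proof -
  have spN: "space (N n) = space P" for n using N(2) by (rule sets_eq_imp_space_eq)
  have spL: "space L = space P" using L(2) by (rule sets_eq_imp_space_eq)
  have "A \<in> sigma_sets (space P) G" using A G(3) by simp
  with G(1,2) show ?thesis
  proof (induction rule: sigma_sets_induct_disjoint)
    case (basic A)
    then show ?case by (rule assms(10))
  next
    case empty
    then show ?case by simp
  next
    case (compl A)
    have Am: "A \<in> sets P" using compl G(3) by simp
    have "measure (N n) (space P - A) = measure (N n) (space P) - measure (N n) A" for n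
      using finite_measure.finite_measure_compl[OF N(1), of A n] N(2) spN Am by simp
    moreover have "measure L (space P - A) = measure L (space P) - measure L A"
      using finite_measure.finite_measure_compl[OF L(1), of A] L(2) spL Am by simp
    ultimately show ?case using tendsto_diff[OF top compl(2)] by simp
  next
    case (union A)
    have Am: "A i \<in> sets P" for i using union(2) G(3) by auto
    have sN: "(\<Sum>i. measure (N n) (A i)) = measure (N n) (\<Union>i. A i)" for n
      using finite_measure.finite_measure_UNION[OF N(1), of A n] N(2) Am union(1)
      by (intro sums_unique[symmetric]) auto
    have sL: "(\<Sum>i. measure L (A i)) = measure L (\<Union>i. A i)"
      using finite_measure.finite_measure_UNION[OF L(1), of A] L(2) Am union(1)
      by (intro sums_unique[symmetric]) auto
    have sP: "summable (\<lambda>i. measure P (A i))"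
      using finite_measure.finite_measure_UNION[OF P, of A] Am union(1)
      by (intro sums_summable) auto
    have "(\<lambda>n. \<Sum>i. measure (N n) (A i)) \<longlonglongrightarrow> (\<Sum>i. measure L (A i))"
      using tannerys_theorem[of "\<lambda>i n. measure (N n) (A i)" "\<lambda>i. measure L (A i)" sequentially "\<lambda>i. measure P (A i)"]
        union(3) sP dom Am by (auto intro!: always_eventually)
    then show ?case unfolding sN sL .
  qed
qed

lemma coupling_simps:
  assumes "\<gamma> \<in> couplings M M"
  shows "prob_space \<gamma>" "sets \<gamma> = sets (M \<Otimes>\<^sub>M M)" "space \<gamma> = space M \<times> space M"
    "A \<in> sets M \<Longrightarrow> measure \<gamma> (A \<times> space M) = measure M A"
    "A \<in> sets M \<Longrightarrow> measure \<gamma> (space M \<times> A) = measure M A"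
proof -
  show 1: "prob_space \<gamma>" "sets \<gamma> = sets (M \<Otimes>\<^sub>M M)" using assms by (auto simp: couplings_def)
  show 2: "space \<gamma> = space M \<times> space M"
    using sets_eq_imp_space_eq[OF 1(2)] by (simp add: space_pair_measure)
  have m: "fst \<in> \<gamma> \<rightarrow>\<^sub>M M" "snd \<in> \<gamma> \<rightarrow>\<^sub>M M"
    using measurable_fst measurable_snd 1(2) by (metis measurable_cong_sets)+
  assume A: "A \<in> sets M"
  have "measure (distr \<gamma> M fst) A = measure \<gamma> (A \<times> space M)"
    using A m sets.sets_into_space[OF A] by (simp add: measure_distr 2 vimage_fst Times_Int_Times Int_absorb2)
  then show "measure \<gamma> (A \<times> space M) = measure M A" using assms by (simp add: couplings_def)
  have "measure (distr \<gamma> M snd) A = measure \<gamma> (space M \<times> A)"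
    using A m sets.sets_into_space[OF A] by (simp add: measure_distr 2 vimage_snd Times_Int_Times Int_absorb2)
  then show "measure \<gamma> (space M \<times> A) = measure M A" using assms by (simp add: couplings_def)
qed

text \<open>Fixing one side of a rectangle turns a coupling into a finite measure in the other
  side, so that \<open>setwise_convergence_from_generator\<close> can be used one side at a time.\<close>

lemma coupling_section:
  assumes \<gamma>: "\<gamma> \<in> couplings M M" and B: "B \<in> sets M"
  defines "L \<equiv> distr (density \<gamma> (indicator (space M \<times> B))) M fst"
    and "R \<equiv> distr (density \<gamma> (indicator (B \<times> space M))) M snd"
  shows "finite_measure L" "sets L = sets M" "A \<in> sets M \<Longrightarrow> measure L A = measure \<gamma> (A \<times> B)"
    "finite_measure R" "sets R = sets M" "A \<in> sets M \<Longrightarrow> measure R A = measure \<gamma> (B \<times> A)"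
proof -
  note c = coupling_simps[OF \<gamma>]
  interpret prob_space \<gamma> by (rule c(1))
  have m: "fst \<in> \<gamma> \<rightarrow>\<^sub>M M" "snd \<in> \<gamma> \<rightarrow>\<^sub>M M"
    using measurable_fst measurable_snd c(2) by (metis measurable_cong_sets)+
  have rect: "A \<times> C \<in> sets \<gamma>" if "A \<in> sets M" "C \<in> sets M" for A C
    using that c(2) by simp
  have eL: "emeasure L A = emeasure \<gamma> (A \<times> B)" if A: "A \<in> sets M" for A
  proof -
    have "emeasure L A = emeasure (density \<gamma> (indicator (space M \<times> B))) (A \<times> space M)"
      unfolding L_def using A m sets.sets_into_space[OF A]
      by (subst emeasure_distr) (auto simp: c(3) vimage_fst Times_Int_Times Int_absorb2)
    also have "\<dots> = (\<integral>\<^sup>+z. indicator (space M \<times> B) z * indicator (A \<times> space M) z \<partial>\<gamma>)"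
      using rect A B by (intro emeasure_density) auto
    also have "\<dots> = (\<integral>\<^sup>+z. indicator (A \<times> B) z \<partial>\<gamma>)"
      using sets.sets_into_space[OF A] sets.sets_into_space[OF B]
      by (intro nn_integral_cong) (auto simp: indicator_def)
    finally show ?thesis using rect A B by simp
  qed
  have eR: "emeasure R A = emeasure \<gamma> (B \<times> A)" if A: "A \<in> sets M" for A
  proof -
    have "emeasure R A = emeasure (density \<gamma> (indicator (B \<times> space M))) (space M \<times> A)"
      unfolding R_def using A m sets.sets_into_space[OF A]
      by (subst emeasure_distr) (auto simp: c(3) vimage_snd Times_Int_Times Int_absorb2)
    also have "\<dots> = (\<integral>\<^sup>+z. indicator (B \<times> space M) z * indicator (space M \<times> A) z \<partial>\<gamma>)"
      using rect A B by (intro emeasure_density) auto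
    also have "\<dots> = (\<integral>\<^sup>+z. indicator (B \<times> A) z \<partial>\<gamma>)"
      using sets.sets_into_space[OF A] sets.sets_into_space[OF B]
      by (intro nn_integral_cong) (auto simp: indicator_def)
    finally show ?thesis using rect A B by simp
  qed
  show "sets L = sets M" "sets R = sets M" by (simp_all add: L_def R_def)
  show "measure L A = measure \<gamma> (A \<times> B)" "measure R A = measure \<gamma> (B \<times> A)" if "A \<in> sets M"
    using eL[OF that] eR[OF that] by (simp_all add: measure_def)
  show "finite_measure L" "finite_measure R"
    using eL[of "space M"] eR[of "space M"]
    by (auto intro!: finite_measureI simp: L_def R_def)
qed

text \<open>The marginals of all the couplings equal \<open>M\<close>, which therefore dominates every section.\<close>

lemma rectangles_converge:
  assumes M: "prob_space M" and \<mu>: "\<And>n. \<mu> n \<in> couplings M M" and \<nu>: "\<nu> \<in> couplings M M"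
    and G: "Int_stable G" "G \<subseteq> Pow (space M)" "sigma_sets (space M) G = sets M"
    and basic: "\<And>A B. A \<in> G \<Longrightarrow> B \<in> G \<Longrightarrow> (\<lambda>n. measure (\<mu> n) (A \<times> B)) \<longlonglongrightarrow> measure \<nu> (A \<times> B)"
    and AB: "A \<in> sets M" "B \<in> sets M"
  shows "(\<lambda>n. measure (\<mu> n) (A \<times> B)) \<longlonglongrightarrow> measure \<nu> (A \<times> B)"
proof -
  interpret prob_space M by fact
  have Gs: "A \<in> G \<Longrightarrow> A \<in> sets M" for A using G(3) sigma_sets.Basic by blast
  have mono: "measure (\<mu> n) (A \<times> B) \<le> measure (\<mu> n) (A' \<times> B')"
    if "A' \<in> sets M" "B' \<in> sets M" "A \<subseteq> A'" "B \<subseteq> B'" for n A B A' B'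
    using that coupling_simps[OF \<mu>[of n]]
    by (intro finite_measure.finite_measure_mono prob_space.finite_measure) auto
  have into: "A \<subseteq> space M" if "A \<in> sets M" for A using that by (rule sets.sets_into_space)
  have step1: "(\<lambda>n. measure (\<mu> n) (A \<times> B)) \<longlonglongrightarrow> measure \<nu> (A \<times> B)" if "A \<in> sets M" "B \<in> G" for A B
  proof -
    note sN = coupling_section[OF \<mu> Gs[OF \<open>B \<in> G\<close>]] and sL = coupling_section[OF \<nu> Gs[OF \<open>B \<in> G\<close>]]
    let ?N = "\<lambda>n. distr (density (\<mu> n) (indicator (space M \<times> B))) M fst"
    let ?L = "distr (density \<nu> (indicator (space M \<times> B))) M fst"
    have "(\<lambda>n. measure (?N n) A) \<longlonglongrightarrow> measure ?L A"
    proof (rule setwise_convergence_from_generator[where P=M and G=G])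
      show "measure (?N n) A \<le> measure M A" if "A \<in> sets M" for n A
        using mono[OF that sets.top[of M] subset_refl into[OF Gs[OF \<open>B \<in> G\<close>]], of n]
          coupling_simps(4)[OF \<mu> that, of n] sN(3)[OF that, of n] by simp
      show "(\<lambda>n. measure (?N n) A) \<longlonglongrightarrow> measure ?L A" if "A \<in> G" for A
        using basic[OF that \<open>B \<in> G\<close>] sN(3)[OF Gs[OF that]] sL(3)[OF Gs[OF that]] by simp
      show "(\<lambda>n. measure (?N n) (space M)) \<longlonglongrightarrow> measure ?L (space M)"
        using sN(3)[OF sets.top] sL(3)[OF sets.top] coupling_simps(5)[OF \<mu> Gs[OF \<open>B \<in> G\<close>]]
          coupling_simps(5)[OF \<nu> Gs[OF \<open>B \<in> G\<close>]] by simp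
    qed (use that sN(1) sL(1) G finite_measure_axioms in auto)
    then show ?thesis using sN(3)[OF that(1)] sL(3)[OF that(1)] by simp
  qed
  note sN = coupling_section[OF \<mu> AB(1)] and sL = coupling_section[OF \<nu> AB(1)]
  let ?N = "\<lambda>n. distr (density (\<mu> n) (indicator (A \<times> space M))) M snd"
  let ?L = "distr (density \<nu> (indicator (A \<times> space M))) M snd"
  have "(\<lambda>n. measure (?N n) B) \<longlonglongrightarrow> measure ?L B"
  proof (rule setwise_convergence_from_generator[where P=M and G=G])
    show "measure (?N n) B \<le> measure M B" if "B \<in> sets M" for n B
      using mono[OF sets.top[of M] that into[OF AB(1)] subset_refl, of n]
        coupling_simps(5)[OF \<mu> that, of n] sN(6)[OF that, of n] by simp
    show "(\<lambda>n. measure (?N n) B) \<longlonglongrightarrow> measure ?L B" if "B \<in> G" for B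
      using step1[OF AB(1) that] sN(6)[OF Gs[OF that]] sL(6)[OF Gs[OF that]] by simp
    show "(\<lambda>n. measure (?N n) (space M)) \<longlonglongrightarrow> measure ?L (space M)"
      using sN(6)[OF sets.top] sL(6)[OF sets.top] coupling_simps(4)[OF \<mu> AB(1)]
        coupling_simps(4)[OF \<nu> AB(1)] by simp
  qed (use AB sN(4) sL(4) G finite_measure_axioms in auto)
  then show ?thesis using sN(6)[OF AB(2)] sL(6)[OF AB(2)] by simp
qed

section \<open>Narrow convergence\<close>

text \<open>Let \<open>atom k S\<close> be the atoms of the finite partition generated by the first \<open>k\<close> members of a countable
  base. Replacing \<open>f\<close> on every product of two atoms by its infimum there gives a step function \<open>h k \<le> f\<close>
  over rectangles, and \<open>h k\<close> tends to \<open>f\<close> pointwise because \<open>f\<close> is continuous. Integrals of \<open>h k\<close> converge by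
  hypothesis, so the integrals of \<open>f\<close> are asymptotically bounded below.\<close>

lemma lower_integral_convergence:
  assumes gen: "polish_topology_generating \<tau> M"
    and \<mu>: "\<And>n. \<mu> n \<in> couplings M M" and \<nu>: "\<nu> \<in> couplings M M"
    and rect: "\<And>A B. A \<in> sets M \<Longrightarrow> B \<in> sets M \<Longrightarrow>
        (\<lambda>n. measure (\<mu> n) (A \<times> B)) \<longlonglongrightarrow> measure \<nu> (A \<times> B)"
    and f: "continuous_map (prod_topology \<tau> \<tau>) euclideanreal f"
    and bd: "\<And>z. z \<in> space M \<times> space M \<Longrightarrow> \<bar>f z\<bar> \<le> C"
    and e: "e > 0"
  shows "\<forall>\<^sub>F n in sequentially. integral\<^sup>L \<nu> f - e < integral\<^sup>L (\<mu> n) f"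
proof -
  have sp: "topspace \<tau> = space M" by (rule generating_space[OF gen])
  let ?S = "space M \<times> space M"
  have fm: "f \<in> borel_measurable \<kappa>" if \<kappa>: "\<kappa> \<in> couplings M M" for \<kappa>
  proof (rule borel_measurableI)
    fix W :: "real set" assume "open W"
    then have "openin (prod_topology \<tau> \<tau>) {z \<in> topspace (prod_topology \<tau> \<tau>). f z \<in> W}"
      using f by (intro openin_continuous_map_preimage[OF f]) simp
    then have "{z \<in> topspace (prod_topology \<tau> \<tau>). f z \<in> W} \<in> sets (borel_of (prod_topology \<tau> \<tau>))"
      by (auto intro: sigma_sets.Basic)
    moreover have "{z \<in> topspace (prod_topology \<tau> \<tau>). f z \<in> W} = f -` W \<inter> space \<kappa>"
      by (auto simp: sp coupling_simps(3)[OF \<kappa>])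
    ultimately show "f -` W \<inter> space \<kappa> \<in> sets \<kappa>"
      unfolding borel_of_prod_topology[OF gen] coupling_simps(2)[OF \<kappa>] by simp
  qed
  have fint: "integrable \<kappa> f" if \<kappa>: "\<kappa> \<in> couplings M M" for \<kappa>
  proof -
    interpret prob_space \<kappa> by (rule coupling_simps(1)[OF \<kappa>])
    have "AE z in \<kappa>. norm (f z) \<le> C"
      using bd coupling_simps(3)[OF \<kappa>] by (intro AE_I2) simp
    then show ?thesis using fm[OF \<kappa>] by (rule integrable_const_bound)
  qed
  have "second_countable \<tau>"
    using gen by (intro polish_imp_second_countable) (simp add: polish_topology_generating_def)
  then obtain \<B> where \<B>: "countable \<B>" "\<forall>V\<in>\<B>. openin \<tau> V"
      and base: "\<forall>U x. openin \<tau> U \<and> x \<in> U \<longrightarrow> (\<exists>V\<in>\<B>. x \<in> V \<and> V \<subseteq> U)"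
    unfolding second_countable_def by auto
  \<comment> \<open>The empty set is added so that the enumeration is defined also for an empty base.\<close>
  define U where "U = from_nat_into (insert {} \<B>)"
  have rU: "range U = insert {} \<B>" unfolding U_def using \<B>(1) by (intro range_from_nat_into) auto
  then have Uop: "openin \<tau> (U i)" for i using \<B>(2) by (metis insertE openin_empty rangeI)
  have Us: "U i \<in> sets M" for i by (rule generating_open[OF gen Uop])
  have Ubase: "\<exists>i. x \<in> U i \<and> U i \<subseteq> W" if W: "openin \<tau> W" "x \<in> W" for W x
  proof -
    obtain V where "V \<in> \<B>" "x \<in> V" "V \<subseteq> W" using base W by blast
    moreover have "V \<in> range U" using rU \<open>V \<in> \<B>\<close> by simp
    ultimately show ?thesis by auto
  qed
  define sig where "sig k x = {i. i < k \<and> x \<in> U i}" for k x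
  define atom where "atom k S = {x \<in> space M. sig k x = S}" for k S
  have atom_sets: "atom k S \<in> sets M" for k S
  proof (cases "S \<subseteq> {..<k}")
    case True
    have "atom k S = (space M \<inter> (\<Inter>i\<in>{..<k}. if i \<in> S then U i \<inter> space M else space M - U i))"
      unfolding atom_def sig_def using True by (auto split: if_splits)
    also have "\<dots> \<in> sets M"
    proof (cases k)
      case (Suc k')
      then show ?thesis using Us by (intro sets.Int sets.top sets.finite_INT) auto
    qed simp
    finally show ?thesis .
  next
    case False
    then have "atom k S = {}" by (auto simp: atom_def sig_def)
    then show ?thesis by simp
  qed
  define c where "c k S T = Inf (f ` (atom k S \<times> atom k T))" for k S T
  define h where "h k z = c k (sig k (fst z)) (sig k (snd z))" for k z
  have bdd: "bdd_below (f ` (atom k S \<times> atom k T))" for k S T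
    using bd by (intro bdd_belowI2[of _ "-C"]) (force simp: atom_def abs_le_iff)
  have hf: "h k z \<le> f z" if "z \<in> ?S" for k z
    unfolding h_def c_def using that by (intro cInf_lower bdd) (auto simp: atom_def)
  have hlow: "b \<le> h k z" if "z \<in> ?S" "\<And>w. w \<in> ?S \<Longrightarrow> sig k (fst w) = sig k (fst z) \<Longrightarrow>
      sig k (snd w) = sig k (snd z) \<Longrightarrow> b \<le> f w" for k z b
    unfolding h_def c_def using that(1)
    by (intro cInf_greatest) (auto simp: atom_def intro!: that(2))
  have hbd: "\<bar>h k z\<bar> \<le> C" if "z \<in> ?S" for k z
  proof -
    have "- C \<le> h k z" using bd by (intro hlow that) (force simp: abs_le_iff)
    moreover have "h k z \<le> C" using hf[OF that, of k] bd[OF that] by simp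
    ultimately show ?thesis by simp
  qed
  have hlim: "(\<lambda>k. h k z) \<longlonglongrightarrow> f z" if z: "z \<in> ?S" for z
  proof (rule LIMSEQ_I)
    fix d :: real assume d: "d > 0"
    obtain x y where xy: "z = (x, y)" by (cases z)
    let ?W = "{w \<in> topspace (prod_topology \<tau> \<tau>). f w \<in> {f z - d / 2 <..}}"
    have "openin (prod_topology \<tau> \<tau>) ?W"
      by (intro openin_continuous_map_preimage[OF f]) simp
    moreover have "(x, y) \<in> ?W" using z d by (simp add: xy sp)
    ultimately obtain A B where AB: "openin \<tau> A" "openin \<tau> B" "x \<in> A" "y \<in> B" "A \<times> B \<subseteq> ?W"
      unfolding openin_prod_topology_alt by meson
    obtain i where i: "x \<in> U i" "U i \<subseteq> A" using Ubase[OF AB(1,3)] by blast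
    obtain j where j: "y \<in> U j" "U j \<subseteq> B" using Ubase[OF AB(2,4)] by blast
    have "norm (h k z - f z) < d" if k: "k \<ge> Suc (max i j)" for k
    proof -
      have "f z - d / 2 \<le> h k z"
      proof (rule hlow[OF z])
        fix w assume w: "sig k (fst w) = sig k (fst z)" "sig k (snd w) = sig k (snd z)"
        have "i \<in> sig k (fst z)" "j \<in> sig k (snd z)" using i j k by (auto simp: sig_def xy)
        then have "fst w \<in> U i" "snd w \<in> U j" unfolding w[symmetric] by (auto simp: sig_def)
        then have "w \<in> A \<times> B" using i j by (auto simp: mem_Times_iff)
        then have "w \<in> ?W" using AB(5) by (rule rev_subsetD)
        then show "f z - d / 2 \<le> f w" by simp
      qed
      then show ?thesis using hf[OF z, of k] d by simp
    qed
    then show "\<exists>no. \<forall>n\<ge>no. norm (h n z - f z) < d" by blast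
  qed
  let ?I = "\<lambda>k. Pow {..<k} \<times> Pow {..<k}"
  have hsum: "h k z = (\<Sum>p\<in>?I k. c k (fst p) (snd p) * indicator (atom k (fst p) \<times> atom k (snd p)) z)"
    if "z \<in> ?S" for k z
  proof -
    let ?p = "(sig k (fst z), sig k (snd z))"
    have p: "?p \<in> ?I k" by (auto simp: sig_def)
    have ind: "indicator (atom k (fst p) \<times> atom k (snd p)) z = (if p = ?p then 1 else 0 :: real)" for p
      using that by (cases p; cases z) (auto simp: atom_def indicator_def)
    have "(\<Sum>p\<in>?I k. c k (fst p) (snd p) * indicator (atom k (fst p) \<times> atom k (snd p)) z)
        = (\<Sum>p\<in>?I k. if p = ?p then c k (fst p) (snd p) else 0)"
      by (intro sum.cong refl) (simp only: ind mult_1_right mult_zero_right split: if_split, simp)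
    also have "\<dots> = c k (fst ?p) (snd ?p)"
      using p by (subst sum.delta) auto
    finally show ?thesis by (simp add: h_def)
  qed
  have rect_sets: "atom k S \<times> atom k T \<in> sets \<kappa>" if "\<kappa> \<in> couplings M M" for \<kappa> k S T
    using atom_sets coupling_simps(2)[OF that] by simp
  have hb: "has_bochner_integral \<kappa> (h k) (\<Sum>p\<in>?I k. c k (fst p) (snd p) * measure \<kappa> (atom k (fst p) \<times> atom k (snd p)))"
    if \<kappa>: "\<kappa> \<in> couplings M M" for \<kappa> k
  proof -
    interpret prob_space \<kappa> by (rule coupling_simps(1)[OF \<kappa>])
    have "has_bochner_integral \<kappa> (\<lambda>z. \<Sum>p\<in>?I k. c k (fst p) (snd p) * indicator (atom k (fst p) \<times> atom k (snd p)) z)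
        (\<Sum>p\<in>?I k. c k (fst p) (snd p) * measure \<kappa> (atom k (fst p) \<times> atom k (snd p)))"
      using rect_sets[OF \<kappa>]
      by (intro has_bochner_integral_sum has_bochner_integral_mult_right has_bochner_integral_real_indicator)
        (auto simp: emeasure_eq_measure)
    then show ?thesis
      by (rule has_bochner_integral_cong[THEN iffD1, rotated -1]) (simp_all add: hsum coupling_simps(3)[OF \<kappa>])
  qed
  have hconv: "(\<lambda>n. integral\<^sup>L (\<mu> n) (h k)) \<longlonglongrightarrow> integral\<^sup>L \<nu> (h k)" for k
    unfolding has_bochner_integral_integral_eq[OF hb[OF \<mu>]] has_bochner_integral_integral_eq[OF hb[OF \<nu>]]
    by (intro tendsto_sum tendsto_mult_left rect atom_sets)
  have "(\<lambda>k. integral\<^sup>L \<nu> (h k)) \<longlonglongrightarrow> integral\<^sup>L \<nu> f"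
  proof (rule integral_dominated_convergence[where w="\<lambda>_. C"])
    show "integrable \<nu> (\<lambda>_. C)" using coupling_simps(1)[OF \<nu>] by (simp add: prob_space.finite_measure finite_measure.integrable_const)
    show "h k \<in> borel_measurable \<nu>" for k
      using hb[OF \<nu>, of k] by (auto simp: has_bochner_integral_iff)
  qed (use fm[OF \<nu>] hlim hbd coupling_simps(3)[OF \<nu>] in auto)
  then have "\<forall>\<^sub>F k in sequentially. integral\<^sup>L \<nu> f - e < integral\<^sup>L \<nu> (h k)"
    using e by (intro order_tendstoD(1)) auto
  then obtain k where "integral\<^sup>L \<nu> f - e < integral\<^sup>L \<nu> (h k)"
    by (auto simp: eventually_sequentially)
  with hconv have "\<forall>\<^sub>F n in sequentially. integral\<^sup>L \<nu> f - e < integral\<^sup>L (\<mu> n) (h k)"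
    by (rule order_tendstoD(1))
  then show ?thesis
  proof eventually_elim
    case (elim n)
    have "integral\<^sup>L (\<mu> n) (h k) \<le> integral\<^sup>L (\<mu> n) f"
      using hb[OF \<mu>, of n k] fint[OF \<mu>, of n] hf coupling_simps(3)[OF \<mu>, of n]
      by (intro integral_mono) (auto simp: has_bochner_integral_iff)
    then show ?case using elim by simp
  qed
qed

text \<open>Apply the lower bound to \<open>f\<close> and to \<open>- f\<close>.\<close>

lemma narrow_convergence_of_rectangles:
  assumes gen: "polish_topology_generating \<tau> M"
    and \<mu>: "\<And>n. \<mu> n \<in> couplings M M" and \<nu>: "\<nu> \<in> couplings M M"
    and rect: "\<And>A B. A \<in> sets M \<Longrightarrow> B \<in> sets M \<Longrightarrow>
        (\<lambda>n. measure (\<mu> n) (A \<times> B)) \<longlonglongrightarrow> measure \<nu> (A \<times> B)"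
  shows "converges_narrowly (prod_topology \<tau> \<tau>) \<mu> \<nu>"
proof -
  have sp: "topspace \<tau> = space M" by (rule generating_space[OF gen])
  have prob: "\<kappa> \<in> borel_probabilities (prod_topology \<tau> \<tau>)" if "\<kappa> \<in> couplings M M" for \<kappa>
    unfolding borel_probabilities_def borel_of_prod_topology[OF gen]
    using coupling_simps(1,2)[OF that] by blast
  have "(\<lambda>n. integral\<^sup>L (\<mu> n) f) \<longlonglongrightarrow> integral\<^sup>L \<nu> f"
    if f: "continuous_map (prod_topology \<tau> \<tau>) euclideanreal f" "bounded (f ` topspace (prod_topology \<tau> \<tau>))" for f
  proof -
    obtain C where C: "\<And>z. z \<in> space M \<times> space M \<Longrightarrow> \<bar>f z\<bar> \<le> C"
      using f(2) by (auto simp: bounded_iff sp)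
    have f': "continuous_map (prod_topology \<tau> \<tau>) euclideanreal (\<lambda>z. - f z)"
      using f(1) by (rule continuous_map_minus)
    show ?thesis
    proof (rule order_tendstoI)
      fix a assume "a < integral\<^sup>L \<nu> f"
      then have "0 < integral\<^sup>L \<nu> f - a" by simp
      from lower_integral_convergence[OF gen \<mu> \<nu> rect f(1) C this]
      show "\<forall>\<^sub>F n in sequentially. a < integral\<^sup>L (\<mu> n) f" by (rule eventually_mono) simp_all
    next
      fix a assume "integral\<^sup>L \<nu> f < a"
      then have pos: "0 < a - integral\<^sup>L \<nu> f" by simp
      have "\<bar>- f z\<bar> \<le> C" if "z \<in> space M \<times> space M" for z using C[OF that] by simp
      from lower_integral_convergence[OF gen \<mu> \<nu> rect f' this pos]
      show "\<forall>\<^sub>F n in sequentially. integral\<^sup>L (\<mu> n) f < a" by (rule eventually_mono) simp_all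
    qed
  qed
  then show ?thesis unfolding converges_narrowly_def using prob \<mu> \<nu> by blast
qed

section \<open>Approximating a coupling by graphs\<close>

lemma graph_coupling:
  assumes M: "prob_space M" and g: "g \<in> S_maps M"
  shows "distr M (M \<Otimes>\<^sub>M M) (\<lambda>x. (x, g x)) \<in> couplings M M"
proof -
  interpret prob_space M by fact
  have gm: "g \<in> M \<rightarrow>\<^sub>M M" "distr M M g = M" using g by (auto simp: S_maps_def)
  have pm: "(\<lambda>x. (x, g x)) \<in> M \<rightarrow>\<^sub>M M \<Otimes>\<^sub>M M"
    by (rule measurable_Pair[OF measurable_ident_sets[OF refl] gm(1)])
  have "distr (distr M (M \<Otimes>\<^sub>M M) (\<lambda>x. (x, g x))) M fst = distr M M (fst \<circ> (\<lambda>x. (x, g x)))"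
    by (rule distr_distr[OF measurable_fst pm])
  also have "fst \<circ> (\<lambda>x. (x, g x)) = (\<lambda>x. x)" by auto
  finally have fst: "distr (distr M (M \<Otimes>\<^sub>M M) (\<lambda>x. (x, g x))) M fst = M"
    by (simp only: distr_id)
  have "distr (distr M (M \<Otimes>\<^sub>M M) (\<lambda>x. (x, g x))) M snd = distr M M (snd \<circ> (\<lambda>x. (x, g x)))"
    by (rule distr_distr[OF measurable_snd pm])
  also have "snd \<circ> (\<lambda>x. (x, g x)) = g" by auto
  finally have snd: "distr (distr M (M \<Otimes>\<^sub>M M) (\<lambda>x. (x, g x))) M snd = M"
    by (simp only: gm(2))
  show ?thesis
    unfolding couplings_def using prob_space_distr[OF pm] fst snd by simp
qed

lemma graph_measure_rectangle:
  assumes g: "g \<in> S_maps M" and "A \<in> sets M" "B \<in> sets M"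
  shows "measure (distr M (M \<Otimes>\<^sub>M M) (\<lambda>x. (x, g x))) (A \<times> B) = measure M (A \<inter> (g -` B \<inter> space M))"
proof -
  have gm: "g \<in> M \<rightarrow>\<^sub>M M" using g by (auto simp: S_maps_def)
  have pm: "(\<lambda>x. (x, g x)) \<in> M \<rightarrow>\<^sub>M M \<Otimes>\<^sub>M M"
    by (rule measurable_Pair[OF measurable_ident_sets[OF refl] gm])
  have "(\<lambda>x. (x, g x)) -` (A \<times> B) \<inter> space M = A \<inter> (g -` B \<inter> space M)" by auto
  moreover have "A \<times> B \<in> sets (M \<Otimes>\<^sub>M M)" using assms(2,3) by (rule pair_measureI)
  ultimately show ?thesis by (simp only: measure_distr[OF pm])
qed

context cell_tree begin

lemma measure_cell_union:
  assumes \<mu>: "\<mu> \<in> couplings M M" and S: "S \<subseteq> {..<c n} \<times> {..<c n}"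
  shows "measure \<mu> (\<Union>p\<in>S. Q n (fst p) \<times> Q n (snd p)) = (\<Sum>p\<in>S. measure \<mu> (Q n (fst p) \<times> Q n (snd p)))"
proof -
  interpret \<mu>: prob_space \<mu> by (rule coupling_simps(1)[OF \<mu>])
  have "finite S" using S by (rule finite_subset) auto
  moreover have "Q n (fst p) \<times> Q n (snd p) \<in> sets \<mu>" if "p \<in> S" for p
    using S that unfolding coupling_simps(2)[OF \<mu>] by (intro pair_measureI) auto
  moreover have "disjoint_family_on (\<lambda>p. Q n (fst p) \<times> Q n (snd p)) S"
    unfolding disjoint_family_on_def
  proof (intro ballI impI)
    fix p q assume pq: "p \<in> S" "q \<in> S" "p \<noteq> q"
    show "Q n (fst p) \<times> Q n (snd p) \<inter> Q n (fst q) \<times> Q n (snd q) = {}"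
    proof (rule ccontr)
      assume "\<not> ?thesis"
      then obtain z where "fst z \<in> Q n (fst p)" "fst z \<in> Q n (fst q)" "snd z \<in> Q n (snd p)" "snd z \<in> Q n (snd q)"
        by auto
      moreover have "fst p < c n" "snd p < c n" "fst q < c n" "snd q < c n" using S pq by auto
      ultimately have "fst p = fst q" "snd p = snd q"
        using cell_disjoint[of "fst p" n "fst q" "fst z"] cell_disjoint[of "snd p" n "snd q" "snd z"] by simp_all
      then show False using pq(3) by (simp add: prod_eq_iff)
    qed
  qed
  ultimately show ?thesis by (intro \<mu>.finite_measure_finite_Union) auto
qed

lemma all_cells: "(\<Union>p\<in>{..<c n} \<times> {..<c n}. Q n (fst p) \<times> Q n (snd p)) = space M \<times> space M"
proof -
  have "(\<Union>p\<in>{..<c n} \<times> {..<c n}. Q n (fst p) \<times> Q n (snd p)) = (\<Union>k<c n. Q n k) \<times> (\<Union>k<c n. Q n k)"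
    by fastforce
  then show ?thesis unfolding cell_cover .
qed

text \<open>Both couplings have total mass one, so a uniform lower bound for the difference on each of the
  \<open>(c n)\<^sup>2\<close> products of cells also bounds it from above on every union of them, by passing to the
  complementary union.\<close>

lemma close_on_cells:
  assumes \<mu>: "\<mu> \<in> couplings M M" and \<nu>: "\<nu> \<in> couplings M M" and \<delta>: "\<delta> \<ge> 0"
    and low: "\<And>i j. i < c n \<Longrightarrow> j < c n \<Longrightarrow> measure \<nu> (Q n i \<times> Q n j) - \<delta> \<le> measure \<mu> (Q n i \<times> Q n j)"
    and S: "S \<subseteq> {..<c n} \<times> {..<c n}"
  defines "A \<equiv> (\<Union>p\<in>S. Q n (fst p) \<times> Q n (snd p))"
  shows "\<bar>measure \<mu> A - measure \<nu> A\<bar> \<le> real ((c n)\<^sup>2) * \<delta>"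
proof -
  let ?X = "{..<c n} \<times> {..<c n}"
  define d where "d p = measure \<mu> (Q n (fst p) \<times> Q n (snd p)) - measure \<nu> (Q n (fst p) \<times> Q n (snd p))" for p
  have dA: "sum d S = measure \<mu> (\<Union>p\<in>S. Q n (fst p) \<times> Q n (snd p)) - measure \<nu> (\<Union>p\<in>S. Q n (fst p) \<times> Q n (snd p))"
    if "S \<subseteq> ?X" for S
    using measure_cell_union[OF \<mu> that] measure_cell_union[OF \<nu> that] by (simp add: d_def sum_subtractf)
  have tot: "sum d ?X = 0"
    using dA[OF subset_refl] coupling_simps(5)[OF \<mu> sets.top] coupling_simps(5)[OF \<nu> sets.top]
    unfolding all_cells by simp
  have lower: "- (real ((c n)\<^sup>2) * \<delta>) \<le> sum d T" if T: "T \<subseteq> ?X" for T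
  proof -
    have "card T \<le> (c n)\<^sup>2" using card_mono[OF _ T] by (simp add: card_cartesian_product power2_eq_square)
    then have "real (card T) * \<delta> \<le> real ((c n)\<^sup>2) * \<delta>" using \<delta> by (intro mult_right_mono) auto
    moreover have "(\<Sum>p\<in>T. - \<delta>) \<le> sum d T"
    proof (rule sum_mono)
      fix p assume "p \<in> T"
      then have "fst p < c n" "snd p < c n" using T by auto
      from low[OF this] show "- \<delta> \<le> d p" by (simp add: d_def)
    qed
    ultimately show ?thesis by simp
  qed
  have "sum d (?X - S) + sum d S = 0"
    using sum.subset_diff[OF S, of d] tot by simp
  then show ?thesis
    using lower[OF S] lower[of "?X - S"] dA[OF S] unfolding A_def by auto
qed

lemma cell_rectangle_close:
  assumes \<mu>: "\<mu> \<in> couplings M M" and \<nu>: "\<nu> \<in> couplings M M" and \<delta>: "\<delta> \<ge> 0"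
    and low: "\<And>i j. i < c n \<Longrightarrow> j < c n \<Longrightarrow> measure \<nu> (Q n i \<times> Q n j) - \<delta> \<le> measure \<mu> (Q n i \<times> Q n j)"
    and A: "l \<le> n" "i < c l" and B: "m \<le> n" "j < c m"
  shows "\<bar>measure \<mu> (Q l i \<times> Q m j) - measure \<nu> (Q l i \<times> Q m j)\<bar> \<le> real ((c n)\<^sup>2) * \<delta>"
proof -
  let ?I = "{k. k < c n \<and> Q n k \<subseteq> Q l i}" and ?J = "{k. k < c n \<and> Q n k \<subseteq> Q m j}"
  have un: "(\<Union>p\<in>?I \<times> ?J. Q n (fst p) \<times> Q n (snd p)) = Q l i \<times> Q m j"
    (is "?U = _")
  proof -
    have "?U = (\<Union>k\<in>?I. Q n k) \<times> (\<Union>k\<in>?J. Q n k)" by fastforce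
    also have "(\<Union>k\<in>?I. Q n k) = Q l i" by (rule cell_eq_Union[OF A, symmetric])
    also have "(\<Union>k\<in>?J. Q n k) = Q m j" by (rule cell_eq_Union[OF B, symmetric])
    finally show ?thesis .
  qed
  have "?I \<times> ?J \<subseteq> {..<c n} \<times> {..<c n}" by auto
  from close_on_cells[OF \<mu> \<nu> \<delta> low this] show ?thesis unfolding un by simp
qed

lemma permutation_measurable:
  assumes \<sigma>: "bij_betw \<sigma> {..<c n} {..<c n}" and g: "g \<in> M \<rightarrow>\<^sub>M M"
    and maps: "\<And>k. k < c n \<Longrightarrow> g ` Q n k \<subseteq> Q n (\<sigma> k)"
  shows "g \<in> sigma (space M) (Q n ` {..<c n}) \<rightarrow>\<^sub>M sigma (space M) (Q n ` {..<c n})"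
proof (rule measurable_measure_of)
  show "Q n ` {..<c n} \<subseteq> Pow (space M)" using cell_space by auto
  then have [simp]: "space (sigma (space M) (Q n ` {..<c n})) = space M"
     "sets (sigma (space M) (Q n ` {..<c n})) = sigma_sets (space M) (Q n ` {..<c n})" by simp_all
  show "g \<in> space (sigma (space M) (Q n ` {..<c n})) \<rightarrow> space M"
    using measurable_space[OF g] by auto
  fix B assume "B \<in> Q n ` {..<c n}"
  then obtain j where "j < c n" "B = Q n j" by auto
  moreover have "j \<in> \<sigma> ` {..<c n}" using bij_betw_imp_surj_on[OF \<sigma>] \<open>j < c n\<close> by simp
  ultimately obtain k where k: "k < c n" "B = Q n (\<sigma> k)" by auto
  have "g -` B \<inter> space M = Q n k"
  proof
    show "Q n k \<subseteq> g -` B \<inter> space M" using maps[OF k(1)] cell_space[OF k(1)] k(2) by auto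
    show "g -` B \<inter> space M \<subseteq> Q n k"
    proof
      fix x assume x: "x \<in> g -` B \<inter> space M"
      then have l: "code n x < c n" "x \<in> Q n (code n x)" using code by auto
      then have "g x \<in> Q n (\<sigma> (code n x))" "g x \<in> Q n (\<sigma> k)" using maps x k by auto
      then have "\<sigma> (code n x) = \<sigma> k"
        using cell_disjoint[of "\<sigma> (code n x)" n "\<sigma> k" "g x"] bij_betw_apply[OF \<sigma>, of "code n x"]
          bij_betw_apply[OF \<sigma>, of k] l k by simp
      then have "code n x = k"
        using bij_betw_imp_inj_on[OF \<sigma>] l k by (auto dest: inj_onD)
      then show "x \<in> Q n k" using l by simp
    qed
  qed
  then show "g -` B \<inter> space (sigma (space M) (Q n ` {..<c n})) \<in> sets (sigma (space M) (Q n ` {..<c n}))"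
    using k by (auto intro: sigma_sets.Basic)
qed

text \<open>Round \<open>c (n + 1)\<close> times the masses of \<open>\<gamma>\<close> down to integers: their row and column sums are at
  most \<open>r n\<close>, the number of cells of level \<open>n + 1\<close> in a cell of level \<open>n\<close>, so a permutation of the cells of level \<open>n + 1\<close> moves
  at least that many of them between the prescribed blocks. Rounding loses less than one cell of
  measure \<open>1 / c (n + 1)\<close> per block.\<close>

lemma approximate_coupling_by_map:
  assumes sb: "standard_borel M" and \<gamma>: "\<gamma> \<in> couplings M M"
  obtains g where "g \<in> S_maps_sub M (sigma (space M) (Q (Suc n) ` {..<c (Suc n)}))"
    "\<And>i j. i < c n \<Longrightarrow> j < c n \<Longrightarrow> measure \<gamma> (Q n i \<times> Q n j) - 1 / real (c (Suc n))
        \<le> measure (distr M (M \<Otimes>\<^sub>M M) (\<lambda>x. (x, g x))) (Q n i \<times> Q n j)"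
proof -
  interpret \<gamma>: prob_space \<gamma> by (rule coupling_simps(1)[OF \<gamma>])
  let ?C = "c (Suc n)" and ?I = "{..<c n}"
  define b where "b i j = nat \<lfloor>real ?C * measure \<gamma> (Q n i \<times> Q n j)\<rfloor>" for i j
  have b_le: "real (b i j) \<le> real ?C * measure \<gamma> (Q n i \<times> Q n j)" for i j
    unfolding b_def by (simp add: of_nat_nat)
  have b_ge: "real ?C * measure \<gamma> (Q n i \<times> Q n j) - 1 \<le> real (b i j)" for i j
    unfolding b_def by linarith
  have block: "card {x \<in> {..<?C}. x div r n = i} = r n" if "i < c n" for i
  proof -
    have "{x \<in> {..<?C}. x div r n = i} = {i * r n ..< Suc i * r n}"
    proof (rule set_eqI)
      fix x
      have "x div r n = i \<longleftrightarrow> i * r n \<le> x \<and> x < Suc i * r n"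
      proof
        assume "x div r n = i"
        then show "i * r n \<le> x \<and> x < Suc i * r n"
          using div_times_less_eq_dividend[of x "r n"] dividend_less_div_times[OF r_pos, of x n] by simp
      next
        assume "i * r n \<le> x \<and> x < Suc i * r n"
        then show "x div r n = i" by (intro div_nat_eqI) (simp_all add: mult.commute)
      qed
      moreover have "Suc i * r n \<le> ?C" using that by (simp only: c_Suc) (intro mult_le_mono1, simp)
      ultimately show "x \<in> {x \<in> {..<?C}. x div r n = i} \<longleftrightarrow> x \<in> {i * r n ..< Suc i * r n}" by auto
    qed
    then show ?thesis by simp
  qed
  have rC: "real ?C * (1 / real (c n)) = real (r n)" by (simp add: c_Suc)
  have row: "(\<Sum>j\<in>?I. measure \<gamma> (Q n i \<times> Q n j)) = 1 / real (c n)" if i: "i < c n" for i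
  proof -
    have "(\<Sum>j\<in>?I. measure \<gamma> (Q n i \<times> Q n j)) = (\<Sum>p\<in>{i} \<times> ?I. measure \<gamma> (Q n (fst p) \<times> Q n (snd p)))"
      by (subst sum.cartesian_product') simp
    also have "\<dots> = measure \<gamma> (\<Union>p\<in>{i} \<times> ?I. Q n (fst p) \<times> Q n (snd p))"
      using i by (intro measure_cell_union[OF \<gamma>, symmetric]) auto
    also have "(\<Union>p\<in>{i} \<times> ?I. Q n (fst p) \<times> Q n (snd p)) = Q n i \<times> (\<Union>k<c n. Q n k)"
      by auto
    finally show ?thesis using i by (simp add: cell_cover coupling_simps(4)[OF \<gamma>] meas)
  qed
  have col: "(\<Sum>i\<in>?I. measure \<gamma> (Q n i \<times> Q n j)) = 1 / real (c n)" if j: "j < c n" for j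
  proof -
    have "(\<Sum>i\<in>?I. measure \<gamma> (Q n i \<times> Q n j)) = (\<Sum>p\<in>?I \<times> {j}. measure \<gamma> (Q n (fst p) \<times> Q n (snd p)))"
      by (subst sum.cartesian_product') simp
    also have "\<dots> = measure \<gamma> (\<Union>p\<in>?I \<times> {j}. Q n (fst p) \<times> Q n (snd p))"
      using j by (intro measure_cell_union[OF \<gamma>, symmetric]) auto
    also have "(\<Union>p\<in>?I \<times> {j}. Q n (fst p) \<times> Q n (snd p)) = (\<Union>k<c n. Q n k) \<times> Q n j"
      by auto
    finally show ?thesis using j by (simp add: cell_cover coupling_simps(5)[OF \<gamma>] meas)
  qed
  have "\<exists>\<sigma>. bij_betw \<sigma> {..<?C} {..<?C} \<and>
     (\<forall>i\<in>?I. \<forall>j\<in>?I. b i j \<le> card {x \<in> {..<?C}. x div r n = i \<and> \<sigma> x div r n = j})"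
  proof (rule bij_with_block_counts)
    fix i assume i: "i \<in> ?I"
    have "real (\<Sum>j\<in>?I. b i j) \<le> (\<Sum>j\<in>?I. real ?C * measure \<gamma> (Q n i \<times> Q n j))"
      unfolding of_nat_sum by (intro sum_mono b_le)
    also have "\<dots> = real (r n)" using row i rC by (simp add: sum_distrib_left[symmetric])
    finally have "(\<Sum>j\<in>?I. b i j) \<le> r n" by (simp only: of_nat_le_iff)
    then show "(\<Sum>j\<in>?I. b i j) \<le> card {x \<in> {..<?C}. x div r n = i}" using block i by simp
  next
    fix j assume j: "j \<in> ?I"
    have "real (\<Sum>i\<in>?I. b i j) \<le> (\<Sum>i\<in>?I. real ?C * measure \<gamma> (Q n i \<times> Q n j))"
      unfolding of_nat_sum by (intro sum_mono b_le)
    also have "\<dots> = real (r n)" using col j rC by (simp add: sum_distrib_left[symmetric])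
    finally have "(\<Sum>i\<in>?I. b i j) \<le> r n" by (simp only: of_nat_le_iff)
    then show "(\<Sum>i\<in>?I. b i j) \<le> card {x \<in> {..<?C}. x div r n = j}" using block j by simp
  qed auto
  then obtain \<sigma> where \<sigma>: "bij_betw \<sigma> {..<?C} {..<?C}"
    and \<sigma>b: "\<And>i j. i < c n \<Longrightarrow> j < c n \<Longrightarrow> b i j \<le> card {x \<in> {..<?C}. x div r n = i \<and> \<sigma> x div r n = j}"
    by auto
  interpret T: cell_tree M "\<lambda>k. c (Suc n + k)" "\<lambda>k. r (Suc n + k)" "\<lambda>k. Q (Suc n + k)"
    by (rule shift)
  have "bij_betw \<sigma> {..<c (Suc n + 0)} {..<c (Suc n + 0)}" using \<sigma> by simp
  from T.realize_permutation[OF sb this]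
  obtain g where g: "g \<in> S_maps M" "\<And>k. k < ?C \<Longrightarrow> g ` Q (Suc n) k \<subseteq> Q (Suc n) (\<sigma> k)"
    by auto
  have gm: "g \<in> M \<rightarrow>\<^sub>M M" using g by (simp add: S_maps_def)
  have "g \<in> S_maps_sub M (sigma (space M) (Q (Suc n) ` {..<?C}))"
    unfolding S_maps_sub_def using g(1) permutation_measurable[OF \<sigma> gm g(2)] by simp
  moreover have "measure \<gamma> (Q n i \<times> Q n j) - 1 / real ?C
        \<le> measure (distr M (M \<Otimes>\<^sub>M M) (\<lambda>x. (x, g x))) (Q n i \<times> Q n j)" if ij: "i < c n" "j < c n" for i j
  proof -
    let ?K = "{x \<in> {..<?C}. x div r n = i \<and> \<sigma> x div r n = j}"
    have "real ?C * measure \<gamma> (Q n i \<times> Q n j) - 1 \<le> real (card ?K)"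
      using b_ge[of i j] \<sigma>b[OF ij] by linarith
    then have "(real ?C * measure \<gamma> (Q n i \<times> Q n j) - 1) / real ?C \<le> real (card ?K) / real ?C"
      by (intro divide_right_mono) auto
    then have "measure \<gamma> (Q n i \<times> Q n j) - 1 / real ?C \<le> real (card ?K) / real ?C"
      using c_gt_0[of "Suc n"] by (simp add: diff_divide_distrib)
    also have "\<dots> = (\<Sum>k\<in>?K. measure M (Q (Suc n) k))" by (simp add: meas)
    also have "\<dots> = measure M (\<Union>k\<in>?K. Q (Suc n) k)"
      by (intro finite_measure_finite_Union[symmetric])
         (auto simp: disjoint_family_on_def dest: cell_disjoint[of _ "Suc n"])
    also have "\<dots> \<le> measure M (Q n i \<inter> (g -` Q n j \<inter> space M))"
    proof (rule finite_measure_mono)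
      show "(\<Union>k\<in>?K. Q (Suc n) k) \<subseteq> Q n i \<inter> (g -` Q n j \<inter> space M)"
      proof
        fix x assume "x \<in> (\<Union>k\<in>?K. Q (Suc n) k)"
        then obtain k where k: "k < ?C" "k div r n = i" "\<sigma> k div r n = j" "x \<in> Q (Suc n) k" by auto
        have "x \<in> Q n i" using refine[OF k(1)] k by auto
        moreover have "\<sigma> k < ?C" using bij_betw_apply[OF \<sigma>] k(1) by auto
        then have "g x \<in> Q n j" using refine[of "\<sigma> k" n] g(2)[OF k(1)] k by auto
        ultimately show "x \<in> Q n i \<inter> (g -` Q n j \<inter> space M)" using cell_space[OF ij(1)] by auto
      qed
      show "Q n i \<inter> (g -` Q n j \<inter> space M) \<in> sets M"
        using ij by (intro sets.Int cell_sets measurable_sets[OF gm])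
    qed
    also have "\<dots> = measure (distr M (M \<Otimes>\<^sub>M M) (\<lambda>x. (x, g x))) (Q n i \<times> Q n j)"
      using ij by (intro graph_measure_rectangle[symmetric] g cell_sets)
    finally show ?thesis .
  qed
  ultimately show ?thesis by (rule that)
qed

text \<open>The hypothesis \<open>growth\<close> makes the accumulated rounding error \<open>(c n)\<^sup>2 / c (n + 1)\<close> tend to zero. The maps
  are chosen once, before any topology is fixed.\<close>

lemma graphs_converge:
  assumes sb: "standard_borel M" and \<gamma>: "\<gamma> \<in> couplings M M"
    and growth: "\<And>n. Suc n * (c n)\<^sup>2 \<le> c (Suc n)"
  obtains g where "\<And>n. g n \<in> S_maps_sub M (sigma (space M) (Q (Suc n) ` {..<c (Suc n)}))"
    "\<And>\<tau>. polish_topology_generating \<tau> M \<Longrightarrow> converges_narrowly (prod_topology \<tau> \<tau>)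
          (\<lambda>n. distr M (M \<Otimes>\<^sub>M M) (\<lambda>x. (x, g n x))) \<gamma>"
proof -
  have "\<exists>g. \<forall>n. g n \<in> S_maps_sub M (sigma (space M) (Q (Suc n) ` {..<c (Suc n)})) \<and>
    (\<forall>i<c n. \<forall>j<c n. measure \<gamma> (Q n i \<times> Q n j) - 1 / real (c (Suc n))
        \<le> measure (distr M (M \<Otimes>\<^sub>M M) (\<lambda>x. (x, g n x))) (Q n i \<times> Q n j))"
    by (intro choice allI, rule approximate_coupling_by_map[OF sb \<gamma>], intro exI conjI allI impI, assumption, simp)
  then obtain g where g: "\<And>n. g n \<in> S_maps_sub M (sigma (space M) (Q (Suc n) ` {..<c (Suc n)}))"
    and low: "\<And>n i j. i < c n \<Longrightarrow> j < c n \<Longrightarrow> measure \<gamma> (Q n i \<times> Q n j) - 1 / real (c (Suc n))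
        \<le> measure (distr M (M \<Otimes>\<^sub>M M) (\<lambda>x. (x, g n x))) (Q n i \<times> Q n j)"
    by auto
  let ?\<mu> = "\<lambda>n. distr M (M \<Otimes>\<^sub>M M) (\<lambda>x. (x, g n x))"
  have gS: "g n \<in> S_maps M" for n using g[of n] by (simp add: S_maps_sub_def)
  have \<mu>: "?\<mu> n \<in> couplings M M" for n by (rule graph_coupling[OF prob_space_axioms gS])
  have err: "real ((c n)\<^sup>2) * (1 / real (c (Suc n))) \<le> 1 / real (Suc n)" for n
  proof -
    have "real (Suc n) * real ((c n)\<^sup>2) \<le> real (c (Suc n))"
      using growth[of n] by (simp only: of_nat_mult[symmetric] of_nat_le_iff)
    then show ?thesis using c_gt_0[of "Suc n"]
      by (simp add: divide_simps mult.commute del: of_nat_Suc of_nat_power)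
  qed
  have cell_conv: "(\<lambda>n. measure (?\<mu> n) (Q l i \<times> Q m j)) \<longlonglongrightarrow> measure \<gamma> (Q l i \<times> Q m j)"
    if ij: "i < c l" "j < c m" for l m i j
  proof -
    have bound: "\<bar>measure (?\<mu> n) (Q l i \<times> Q m j) - measure \<gamma> (Q l i \<times> Q m j)\<bar> \<le> 1 / real (Suc n)"
      if "max l m \<le> n" for n
    proof -
      have "l \<le> n" "m \<le> n" "0 \<le> 1 / real (c (Suc n))" using that by auto
      from cell_rectangle_close[OF \<mu>[of n] \<gamma> this(3) low this(1) ij(1) this(2) ij(2)]
      show ?thesis using err[of n] by linarith
    qed
    have "(\<lambda>n. measure (?\<mu> n) (Q l i \<times> Q m j) - measure \<gamma> (Q l i \<times> Q m j)) \<longlonglongrightarrow> 0"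
    proof (rule Lim_null_comparison)
      show "\<forall>\<^sub>F n in sequentially.
          norm (measure (?\<mu> n) (Q l i \<times> Q m j) - measure \<gamma> (Q l i \<times> Q m j)) \<le> 1 / real (Suc n)"
        unfolding real_norm_def by (rule eventually_sequentiallyI, rule bound)
      show "(\<lambda>n. 1 / real (Suc n)) \<longlonglongrightarrow> 0"
        using LIMSEQ_inverse_real_of_nat by (simp add: inverse_eq_divide)
    qed
    then show ?thesis by (simp add: LIM_zero_iff)
  qed
  let ?G = "insert {} (\<Union>n. Q n ` {..<c n})"
  have gen_conv: "(\<lambda>n. measure (?\<mu> n) (A \<times> B)) \<longlonglongrightarrow> measure \<gamma> (A \<times> B)"
    if A: "A \<in> ?G" and B: "B \<in> ?G" for A B
  proof (cases "A = {} \<or> B = {}")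
    case False
    then obtain m i n j where ab: "A = Q m i" "i < c m" "B = Q n j" "j < c n"
      using A B by auto
    then show ?thesis using cell_conv by simp
  qed auto
  have rect: "(\<lambda>n. measure (?\<mu> n) (A \<times> B)) \<longlonglongrightarrow> measure \<gamma> (A \<times> B)"
    if "A \<in> sets M" "B \<in> sets M" for A B
    using cell_space
    by (intro rectangles_converge[OF prob_space_axioms \<mu> \<gamma> Int_stable_cells _ generate_empty gen_conv that]) auto
  show ?thesis
    by (rule that[OF g narrow_convergence_of_rectangles[OF _ \<mu> \<gamma> rect]])
qed

end

theorem corollary3p20:
  fixes M :: "'a measure"
    and NN :: "nat set"
    and P :: "nat \<Rightarrow> nat \<Rightarrow> 'a set"
    and \<gamma> :: "('a \<times> 'a) measure"
  assumes "refined_standard_borel_prob_space NN M P"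
    and "\<gamma> \<in> couplings M M"
  shows "\<exists>(N :: nat \<Rightarrow> nat) (g :: nat \<Rightarrow> 'a \<Rightarrow> 'a).
           range N \<subseteq> NN \<and> dvd_totally_ordered (range N) \<and> dvd_strictly_increasing N \<and>
           (\<forall>n. g n \<in> S_maps_sub M (partition_algebra M P (N n))) \<and>
           (\<forall>\<tau> :: 'a topology. polish_topology_generating \<tau> M \<longrightarrow>
              converges_narrowly (prod_topology \<tau> \<tau>)
                (\<lambda>n. distr M (M \<Otimes>\<^sub>M M) (\<lambda>x. (x, g n x))) \<gamma>)"
proof -
  have dir: "dvd_directed_index_set NN" and sb: "standard_borel M" and seg: "segmentation NN M P"
    and pr: "prob_space M"
    using assms(1)
    unfolding refined_standard_borel_prob_space_def refined_standard_borel_measure_space_def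
    by simp_all
  have pos: "N > 0" if "N \<in> NN" for N using dir that by (auto simp: dvd_directed_index_set_def)
  obtain c where c: "\<And>n. c n \<in> NN" "\<And>n. c n dvd c (Suc n)" "\<And>n. c n < c (Suc n)"
    "\<And>n. Suc n * (c n)\<^sup>2 \<le> c (Suc n)" "\<And>N. N \<in> NN \<Longrightarrow> \<exists>n. N dvd c n"
    by (rule index_chain[OF dir]) (rule that)
  interpret cell_tree M c "\<lambda>n. c (Suc n) div c n" "\<lambda>n. P (c n)"
    by (rule segmentation_cell_tree[OF pr seg pos c(1,2,5)])
  obtain g where "\<And>n. g n \<in> S_maps_sub M (sigma (space M) (P (c (Suc n)) ` {..<c (Suc n)}))"
    and conv: "\<And>\<tau>. polish_topology_generating \<tau> M \<Longrightarrow> converges_narrowly (prod_topology \<tau> \<tau>)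
          (\<lambda>n. distr M (M \<Otimes>\<^sub>M M) (\<lambda>x. (x, g n x))) \<gamma>"
    by (rule graphs_converge[OF sb assms(2) c(4)]) (rule that)
  then have g: "\<And>n. g n \<in> S_maps_sub M (partition_algebra M P (c (Suc n)))"
    by (simp add: partition_algebra_def)
  have dvd: "c m dvd c n" if "m \<le> n" for m n
    using that by (induction n rule: dec_induct) (auto intro: dvd_trans c(2))
  have less: "strict_mono c" using c(3) by (rule strict_mono_Suc_iff[THEN iffD2, rule_format])
  have tot: "dvd_totally_ordered (range (\<lambda>n. c (Suc n)))"
    unfolding dvd_totally_ordered_def
  proof (intro ballI)
    fix x y assume "x \<in> range (\<lambda>n. c (Suc n))" "y \<in> range (\<lambda>n. c (Suc n))"
    then obtain m n where "x = c (Suc m)" "y = c (Suc n)" by auto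
    then show "x dvd y \<or> y dvd x" using dvd[of "Suc m" "Suc n"] dvd[of "Suc n" "Suc m"] by (cases "m \<le> n") auto
  qed
  have inc: "dvd_strictly_increasing (\<lambda>n. c (Suc n))"
    unfolding dvd_strictly_increasing_def
  proof (intro allI impI conjI)
    fix i j :: nat assume "i < j"
    then show "c (Suc i) dvd c (Suc j)" by (intro dvd) simp
    have "c (Suc i) < c (Suc j)" using strict_monoD[OF less, of "Suc i" "Suc j"] \<open>i < j\<close> by simp
    then show "c (Suc i) \<noteq> c (Suc j)" by simp
  qed
  have sub: "range (\<lambda>n. c (Suc n)) \<subseteq> NN" using c(1) by (rule image_subsetI)
  show ?thesis
    by (intro exI[of _ "\<lambda>n. c (Suc n)"] exI[of _ g] conjI allI impI sub tot inc g conv)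
qed

end
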